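(* Let $(x_k)$, $(g_k)$, $(d_k)$, $(w_k)$, $(\Delta_k)$, $(B_k)$, $(s_k)$ be generated by the ADAGB2 algorithm (defined in the context, with constants $\varsigma,\tau\in(0,1]$ and $\kappa_s\ge 1$) applied to the problem $\min_{x\in\mathcal F} f(x)$, $\mathcal F=\{x\in\mathbb R^n\mid l_i\le x_i\le u_i,\ i=1,\dots,n\}$. Write $G_k=\nabla f(x_k)$ and $\Xi_k=P_{\mathcal F}(x_k-G_k)-x_k$. Suppose that: (1) $f$ is twice continuously differentiable and $\mathcal F\neq\emptyset$; (2) there is $L\ge 0$ such that $\|\nabla f(x)-\nabla f(y)\|\le L\|x-y\|$ for all $x,y\in\mathbb R^n$; (3) there is $\kappa_B\ge 1$ such that $\|B_k\|\le\kappa_B$ for all $k\ge 0$; (4) there is a constant $f_{\rm low}<f(x_0)$ such that $f(x)\ge f_{\rm low}$ for all $x\in\mathcal F$; (5) there is $\kappa_{Gg}>0$ such that $\mathbb E_k\big[|(G_k-g_k)^Ts_k|\big]\le \kappa_{Gg}^2\,\mathbb E_k\big[\|s_k\|^2\big]$ for all $k\ge 0$. Let $\Gamma_0=f(x_0)-f_{\rm low}$, $\kappa_*=\kappa_s^2\left(\kappa_{Gg}^2+\tfrac12(\kappa_B+L)\right)$ and $$\kappa_{\rm conv}=\frac{4\kappa_B}{\tau\varsigma^2}\left\{1+\Gamma_0+2n\kappa_*\left[\log\left(\frac{8n\kappa_*\kappa_B}{\tau\varsigma^{5/2}}\right)-1\right]\right\}.$$ Then, for all $k\ge 0$, $$\frac1{k+1}\sum_{j=0}^k\mathbb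 E\big[\|\Xi_j\|\big]\le\frac{\kappa_{\rm conv}\,\kappa_1}{\sqrt{k+1}}+\kappa_2\,\frac1{k+1}\sum_{j=0}^k\mathbb E\big[\|g_j-G_j\|\big]+\kappa_3,$$ where: (a) (coherently distributed) $\kappa_1=\kappa_{\rm opt}$ and $\kappa_2=\kappa_3=0$, if $\mathbb E[\|\Xi_k\|]\le\kappa_{\rm opt}\,\mathbb E[\|d_k\|]$ for some constant $\kappa_{\rm opt}>0$ and all $k\ge0$; (b) (controlled error) $\kappa_1=1+\kappa_{\rm err1}$ and $\kappa_2=\kappa_3=0$, if $\mathbb E_k[\|g_k-G_k\|]\le\kappa_{\rm err1}\,\mathbb E_k[\|d_k\|]$ for some constant $\kappa_{\rm err1}>0$ and all $k\ge0$; (c) (probabilistic error control) $\kappa_1=1+\kappa_{\rm pec}$, $\kappa_2=0$ and $\kappa_3=(1-p)\kappa_{\rm err2}$, if, for some $p\in(0,1)$, some $\kappa_{\rm err2},\kappa_{\rm pec}\ge0$ and all $k\ge0$, one has $\|g_k-G_k\|<\kappa_{\rm err2}$ and $\mathbb P_k[\mathcal E_k]\ge p$, where $\mathcal E_k$ is the event $\{\|g_k-G_k\|\le\kappa_{\rm pec}\|d_k\|\}$; (d) (general) $\kappa_1=\kappa_2=1$ and $\kappa_3=0$, otherwise.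
   Context: Problem and notation. $\|\cdot\|$ is the Euclidean norm (and the induced matrix norm). $l,u$ are vectors of bounds, with infinite entries allowed ($l_i=-\infty$, $u_i=+\infty$); $f$ is a real-valued function defined on an open set containing $\mathcal F$ (the Lipschitz hypothesis being stated on all of $\mathbb R^n$ presumes $\nabla f$ is defined there). For a nonempty closed box $S$, $P_S$ is the Euclidean projection onto $S$ (computed componentwise). $v_i$ or $v_{k,i}$ is the $i$-th component of $v$ or $v_k$. ADAGB2 algorithm. Inputs: deterministic $x_{\rm ini}\in\mathbb R^n$, $l$, $u$. Constants $\varsigma,\tau\in(0,1]$, $\kappa_s\ge1$. Set $x_0=P_{\mathcal F}(x_{\rm ini})$ and $w_{-1,i}=\sqrt{\varsigma}$ for all $i$. For $k=0,1,2,\dots$: Step 1. Obtain $g_k=g(x_k,\xi)$, a random approximation of $G_k=\nabla f(x_k)$ (no unbiasedness is assumed). Set $d_k=P_{\mathcal F}(x_k-g_k)-x_k$ and, for each $i$, $w_{k,i}=\sqrt{w_{k-1,i}^2+d_{k,i}^2}$, $\Delta_{k,i}=|d_{k,i}|/w_{k,i}$. Let $\mathcal B_k=\{x\in\mathbb R^n\mid |x_i-x_{k,i}|\le\Delta_{k,i},\ i=1,\dots,n\}$ and $s_k^L=P_{\mathcal F\cap\mathcal B_k}(x_k-g_k)-x_k$. Step 2. Choose a symmetric matrix $B_k\in\mathbb R^{n\times n}$ (an approximation of $\nabla^2 f(x_k)$; any symmetric matrix, including $0$, is allowed). Set $s_k^Q=\gamma_k s_k^L$, where $\gamma_k=\min\left[1,\frac{-g_k^Ts_k^L}{(s_k^L)^TB_ks_k^L}\right]$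 if $(s_k^L)^TB_ks_k^L>0$ and $\gamma_k=1$ otherwise. Select any $s_k$ such that $x_k+s_k\in\mathcal F$, $|s_{k,i}|\le\kappa_s\Delta_{k,i}$ for all $i$, and $g_k^Ts_k+\frac12 s_k^TB_ks_k\le\tau\left(g_k^Ts_k^Q+\frac12(s_k^Q)^TB_ks_k^Q\right)$. Step 3. Set $x_{k+1}=x_k+s_k$. The algorithm generates a random process on a probability space. $\mathbb E_k[\cdot]$ and $\mathbb P_k[\cdot]$ denote expectation and probability conditioned on knowing $g_0,\dots,g_{k-1}$ (the past up to iteration $k$, by which $x_k$ is regarded as determined) and $\mathbb E[\cdot]$ the full expectation. All random quantities are assumed measurable and the expectations well defined; relations between random variables or conditional expectations hold almost surely. *)

theory Defs
  imports "HOL-Probability.Probability"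
begin

definition twice_cont_diff_on :: "(real^'n::finite \<Rightarrow> real) \<Rightarrow> (real^'n) set \<Rightarrow> bool" where
  "twice_cont_diff_on f D \<longleftrightarrow>
     (\<exists>(G :: real^'n \<Rightarrow> real^'n) (H :: real^'n \<Rightarrow> real^'n^'n).
        (\<forall>x\<in>D. (GDERIV f x :> G x) \<and> (G has_derivative (\<lambda>h. H x *v h)) (at x)) \<and>
        continuous_on D H)"

definition quad_model :: "real^'n::finite \<Rightarrow> real^'n^'n \<Rightarrow> real^'n \<Rightarrow> real" where
  "quad_model g B s = g \<bullet> s + (1/2) * (s \<bullet> (B *v s))"

definition trust_region :: "real^'n::finite \<Rightarrow> real^'n \<Rightarrow> (real^'n) set" where
  "trust_region x \<Delta> = {y. \<forall>i. \<bar>y $ i - x $ i\<bar> \<le> \<Delta> $ i}"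

definition lin_step :: "(real^'n::finite) set \<Rightarrow> real^'n \<Rightarrow> real^'n \<Rightarrow> real^'n \<Rightarrow> real^'n" where
  "lin_step F x g \<Delta> = closest_point (F \<inter> trust_region x \<Delta>) (x - g) - x"

definition step_scaling :: "real^'n::finite \<Rightarrow> real^'n^'n \<Rightarrow> real^'n \<Rightarrow> real" where
  "step_scaling g B sL =
     (if sL \<bullet> (B *v sL) > 0 then min 1 (- (g \<bullet> sL) / (sL \<bullet> (B *v sL))) else 1)"

definition quad_step :: "real^'n::finite \<Rightarrow> real^'n^'n \<Rightarrow> real^'n \<Rightarrow> real^'n" where
  "quad_step g B sL = step_scaling g B sL *\<^sub>R sL"

text \<open>The weights are indexed from \<open>-1\<close> in the algorithm; \<open>prev_weight \<sigma> w k\<close> is \<open>w\<close> at index \<open>k - 1\<close>.\<close>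

definition prev_weight :: "real \<Rightarrow> (nat \<Rightarrow> real^'n::finite) \<Rightarrow> nat \<Rightarrow> real^'n" where
  "prev_weight \<sigma> w k = (case k of 0 \<Rightarrow> (\<chi> i. sqrt \<sigma>) | Suc j \<Rightarrow> w j)"

text \<open>\<open>adagb2_run\<close> describes one realisation of the ADAGB2 algorithm. The sequences of gradient
  approximations \<open>g\<close>, of symmetric matrices \<open>B\<close> and of admissible steps \<open>s\<close> are otherwise
  arbitrary.\<close>

definition adagb2_run ::
  "(real^'n::finite) set \<Rightarrow> real \<Rightarrow> real \<Rightarrow> real \<Rightarrow> real^'n \<Rightarrow> (nat \<Rightarrow> real^'n) \<Rightarrow> (nat \<Rightarrow> real^'n) \<Rightarrow>
   (nat \<Rightarrow> real^'n) \<Rightarrow> (nat \<Rightarrow> real^'n) \<Rightarrow> (nat \<Rightarrow> real^'n) \<Rightarrow> (nat \<Rightarrow> real^'n^'n) \<Rightarrow> (nat \<Rightarrow> real^'n) \<Rightarrow> bool"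
where
  "adagb2_run F \<sigma> \<tau> \<kappa>\<^sub>s x_ini x g d w \<Delta> B s \<longleftrightarrow>
     x 0 = closest_point F x_ini \<and>
     (\<forall>k.
        d k = closest_point F (x k - g k) - x k \<and>
        (\<forall>i. w k $ i = sqrt ((prev_weight \<sigma> w k $ i)\<^sup>2 + (d k $ i)\<^sup>2)) \<and>
        (\<forall>i. \<Delta> k $ i = \<bar>d k $ i\<bar> / w k $ i) \<and>
        transpose (B k) = B k \<and>
        x k + s k \<in> F \<and>
        (\<forall>i. \<bar>s k $ i\<bar> \<le> \<kappa>\<^sub>s * \<Delta> k $ i) \<and>
        quad_model (g k) (B k) (s k)
          \<le> \<tau> * quad_model (g k) (B k) (quad_step (g k) (B k) (lin_step F (x k) (g k) (\<Delta> k))) \<and>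
        x (Suc k) = x k + s k)"

text \<open>\<open>past M g k\<close> is the sigma-algebra generated by \<open>g 0, \<dots>, g (k - 1)\<close>; it is trivial for \<open>k = 0\<close>.\<close>

definition past :: "'a measure \<Rightarrow> (nat \<Rightarrow> 'a \<Rightarrow> 'b::topological_space) \<Rightarrow> nat \<Rightarrow> 'a measure" where
  "past M g k = sigma (space M) (\<Union>j<k. {g j -` A \<inter> space M | A. A \<in> sets borel})"

abbreviation cond_exp_past ::
  "'a measure \<Rightarrow> (nat \<Rightarrow> 'a \<Rightarrow> 'b::topological_space) \<Rightarrow> nat \<Rightarrow> ('a \<Rightarrow> real) \<Rightarrow> 'a \<Rightarrow> real" where
  "cond_exp_past M g k \<equiv> real_cond_exp M (past M g k)"

abbreviation cond_prob_past ::
  "'a measure \<Rightarrow> (nat \<Rightarrow> 'a \<Rightarrow> 'b::topological_space) \<Rightarrow> nat \<Rightarrow> 'a set \<Rightarrow> 'a \<Rightarrow> real" where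
  "cond_prob_past M g k A \<equiv> real_cond_exp M (past M g k) (indicator A)"

end

theory Submission
  imports Defs
begin

text \<open>The proof balances two sums along one realisation of the process. Write \<open>P\<close> for the sum of
\<open>d\<^sub>j\<^sub>,\<^sub>i\<^sup>2 / w\<^sub>j\<^sub>,\<^sub>i\<close> and \<open>Q\<close> for the sum of \<open>d\<^sub>j\<^sub>,\<^sub>i\<^sup>2 / w\<^sub>j\<^sub>,\<^sub>i\<^sup>2\<close>, over all components \<open>i\<close> and all iterations
\<open>j \<le> k\<close>. The projections onto the box, taken componentwise, show that every step decreases the
quadratic model by at least a fixed multiple of its term of \<open>P\<close> (lemma \<open>model_decrease\<close>). Passing
from the model to the objective costs the gradient error \<open>\<bar>(G\<^sub>j - g\<^sub>j) \<bullet> s\<^sub>j\<bar>\<close> and a multiple of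
\<open>\<parallel>s\<^sub>j\<parallel>\<^sup>2\<close> (lemma \<open>objective_decrease\<close>). In expectation the error is also at most a multiple of
\<open>\<parallel>s\<^sub>j\<parallel>\<^sup>2\<close>, and \<open>\<parallel>s\<^sub>j\<parallel>\<^sup>2\<close> is controlled by the trust region, hence by the terms of \<open>Q\<close>. Telescoping
and using the lower bound on the objective gives \<open>c E[P] - \<kappa>\<^sub>* E[Q] \<le> \<Gamma>\<^sub>0\<close> with
\<open>c = \<tau> \<surd>\<sigma> / (2 \<kappa>\<^sub>B)\<close>.

The Adagrad weights make \<open>P\<close> large and \<open>Q\<close> small. With \<open>D\<close> the sum of all \<open>\<parallel>d\<^sub>j\<parallel>\<^sup>2\<close> and
\<open>y = \<surd>(1 + D / \<sigma>)\<close>, the sum \<open>P\<close> grows at least linearly in \<open>y\<close>, because no weight exceeds \<open>\<surd>\<sigma> y\<close>, whereas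
\<open>Q\<close> grows at most like \<open>ln y\<close>, because each of its terms is a relative increment of \<open>w\<^sub>i\<^sup>2\<close>. A linear
function dominates a logarithm, so \<open>c P - \<kappa>\<^sub>* Q\<close> bounds \<open>y\<close> up to constants, and \<open>y\<close> bounds
\<open>(\<Sum>j\<le>k. \<parallel>d\<^sub>j\<parallel>) / \<surd>(k + 1)\<close> by the Cauchy-Schwarz inequality (lemma \<open>norm_d_sum_bound\<close>). This
inequality holds along every realisation and is affine in \<open>P\<close> and \<open>Q\<close>, so its expectation can be
combined with the telescoped decrease (lemma \<open>sum_expected_norm_d\<close>).

It remains to pass from \<open>d\<^sub>j\<close> to the exact criticality measure \<open>\<Xi>\<^sub>j\<close>. Nonexpansiveness of the
projection gives \<open>\<parallel>\<Xi>\<^sub>j\<parallel> \<le> \<parallel>d\<^sub>j\<parallel> + \<parallel>g\<^sub>j - G\<^sub>j\<parallel>\<close>, so an assumption on the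
quality of the gradient approximation enters through the bound for \<open>E \<parallel>\<Xi>\<^sub>j\<parallel>\<close> or for
\<open>E \<parallel>g\<^sub>j - G\<^sub>j\<parallel>\<close> that it implies.\<close>

section \<open>Projection onto a box\<close>

lemma closed_ereal_interval: "closed {t. a \<le> ereal t \<and> ereal t \<le> b}"
proof -
  have "closed (ereal -` {a..b} \<inter> UNIV)"
    by (intro continuous_on_closed_vimage[THEN iffD1, rule_format]) (auto intro: continuous_on_ereal)
  also have "ereal -` {a..b} \<inter> UNIV = {t. a \<le> ereal t \<and> ereal t \<le> b}"
    by auto
  finally show ?thesis .
qed

lemma convex_ereal_interval: "convex {t. a \<le> ereal t \<and> ereal t \<le> b}"
proof -
  have "is_interval {t. a \<le> ereal t \<and> ereal t \<le> b}"
    unfolding is_interval_1 by (auto intro: order_trans[of a] order_trans[of "ereal _" "ereal _" b])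
  then show ?thesis
    by (simp add: is_interval_convex_1)
qed

lemma closed_product_box:
  assumes "\<And>i. closed (I i)"
  shows "closed {y :: real^'n::finite. \<forall>i. y $ i \<in> I i}"
proof -
  have "closed (\<Inter>i. (\<lambda>y :: real^'n. y $ i) -` I i)"
    using assms by (intro closed_INT ballI closed_vimage continuous_intros) auto
  also have "(\<Inter>i. (\<lambda>y :: real^'n. y $ i) -` I i) = {y. \<forall>i. y $ i \<in> I i}"
    by auto
  finally show ?thesis .
qed

lemma convex_product_box:
  assumes "\<And>i. convex (I i)"
  shows "convex {y :: real^'n::finite. \<forall>i. y $ i \<in> I i}"
  using assms by (auto simp: convex_def)

text \<open>For a product set the variational inequality of the projection holds in every component separately,
since a single coordinate of the projection can be moved inside its interval without leaving the set.\<close>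

lemma closest_point_box_component:
  fixes a :: "real^'n::finite"
  assumes "\<And>i. closed (I i)" "\<And>i. convex (I i)"
    and S: "S = {y. \<forall>i. y $ i \<in> I i}" and "S \<noteq> {}" and t: "t \<in> I i"
  shows "(a $ i - closest_point S a $ i) * (t - closest_point S a $ i) \<le> 0"
proof -
  define z where "z = closest_point S a"
  define y where "y = (\<chi> j. if j = i then t else z $ j)"
  have closed: "closed S" and convex: "convex S"
    unfolding S using assms(1,2) by (intro closed_product_box convex_product_box; simp)+
  have "z \<in> S"
    unfolding z_def using closed \<open>S \<noteq> {}\<close> by (rule closest_point_in_set)
  then have "y \<in> S"
    using t by (simp add: S y_def)
  then have "(a - z) \<bullet> (y - z) \<le> 0"
    unfolding z_def by (intro closest_point_dot convex closed)
  also have "(a - z) \<bullet> (y - z) = (\<Sum>j\<in>UNIV. if j = i then (a $ i - z $ i) * (t - z $ i) else 0)"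
    unfolding inner_vec_def by (rule sum.cong) (auto simp: y_def)
  finally show ?thesis
    by (simp add: z_def)
qed

section \<open>Decrease of the model\<close>

text \<open>In one coordinate, \<open>u\<close> is the negative gradient, \<open>d\<close> its projection onto the interval of admissible
displacements, and \<open>v\<close> its projection onto the part of that interval inside the trust region, which
contains \<open>\<theta> d\<close>; the hypotheses are the variational inequalities of these projections, tested at
\<open>0\<close> and \<open>\<theta> d\<close>. The point is that \<open>v\<close> reaches at least as far as \<open>\<theta> d\<close> in the direction of \<open>d\<close>, while
\<open>u\<close> reaches at least as far as \<open>d\<close>.\<close>

lemma clipped_step_decrease:
  fixes u d v \<theta> :: real
  assumes "0 \<le> \<theta>" "\<theta> \<le> 1"
    and d: "(u - d) * (0 - d) \<le> 0"
    and v: "(u - v) * (0 - v) \<le> 0" "(u - v) * (\<theta> * d - v) \<le> 0"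
  shows "\<theta> * d\<^sup>2 \<le> u * v"
proof -
  have pos: "\<theta> * d\<^sup>2 \<le> u * v"
    if "0 < d" "(u - d) * (0 - d) \<le> 0" "(u - v) * (0 - v) \<le> 0" "(u - v) * (\<theta> * d - v) \<le> 0"
    for u d v :: real
  proof -
    have "d \<le> u"
      using that(1,2) by (simp add: zero_le_mult_iff)
    have "\<theta> * d \<le> d"
      using that(1) assms(1,2) by (simp add: mult_left_le_one_le)
    have "\<theta> * d \<le> v"
    proof (rule ccontr)
      assume "\<not> \<theta> * d \<le> v"
      with that(4) have "u \<le> v"
        by (simp add: mult_le_0_iff)
      then show False
        using \<open>\<not> \<theta> * d \<le> v\<close> \<open>\<theta> * d \<le> d\<close> \<open>d \<le> u\<close> by simp
    qed
    have "d * (\<theta> * d) \<le> u * v"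
      using \<open>d \<le> u\<close> \<open>\<theta> * d \<le> v\<close> that(1) assms(1) by (intro mult_mono) auto
    then show ?thesis
      by (simp add: power2_eq_square mult_ac)
  qed
  consider "d = 0" | "0 < d" | "d < 0"
    by linarith
  then show ?thesis
  proof cases
    case 1
    have "v * v \<le> u * v"
      using v(1) by (simp add: algebra_simps)
    with 1 show ?thesis
      using order_trans[OF zero_le_square] by simp
  next
    case 2
    then show ?thesis
      using pos d v by blast
  next
    case 3
    then show ?thesis
      using pos[of "-d" "-u" "-v"] d v by (simp add: algebra_simps)
  qed
qed

text \<open>The first inequality keeps the linear decrease large compared with the curvature term of the model;
the second bounds it from below by the projected gradient step. Each \<open>\<theta> i\<close> is a fraction of
\<open>d $ i\<close> that fits into the trust region.\<close>

lemma lin_step_decrease: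
  fixes x g \<Delta> :: "real^'n::finite"
  assumes I: "\<And>i. closed (I i)" "\<And>i. convex (I i)"
    and F: "F = {y. \<forall>i. y $ i \<in> I i}" and x: "x \<in> F"
    and \<Delta>: "\<And>i. 0 \<le> \<Delta> $ i"
    and d: "d = closest_point F (x - g) - x"
    and \<theta>: "\<And>i. 0 \<le> \<theta> i" "\<And>i. \<theta> i \<le> 1" "\<And>i. \<theta> i * \<bar>d $ i\<bar> \<le> \<Delta> $ i"
  shows "lin_step F x g \<Delta> \<bullet> lin_step F x g \<Delta> \<le> - (g \<bullet> lin_step F x g \<Delta>)"
    and "(\<Sum>i\<in>UNIV. \<theta> i * (d $ i)\<^sup>2) \<le> - (g \<bullet> lin_step F x g \<Delta>)"
proof -
  define v where "v = lin_step F x g \<Delta>"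
  define J where "J i = I i \<inter> {x $ i - \<Delta> $ i .. x $ i + \<Delta> $ i}" for i
  have box: "F \<inter> trust_region x \<Delta> = {y. \<forall>i. y $ i \<in> J i}"
    unfolding F trust_region_def J_def
    by (auto simp: abs_le_iff algebra_simps)
  have J: "closed (J i)" "convex (J i)" for i
    unfolding J_def using I by (auto intro: convex_Int)
  have xI: "x $ i \<in> I i" for i
    using x F by auto
  have xJ: "x $ i \<in> J i" for i
    using xI[of i] \<Delta>[of i] by (simp add: J_def)
  then have "x \<in> F \<inter> trust_region x \<Delta>"
    unfolding box by simp
  have v_opt: "(- g $ i - v $ i) * (t - v $ i) \<le> 0" if "x $ i + t \<in> J i" for i t
    using closest_point_box_component[of J "F \<inter> trust_region x \<Delta>" "x $ i + t" i "x - g"]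
      J box \<open>x \<in> F \<inter> _\<close> that
    by (auto simp: v_def lin_step_def algebra_simps)
  have d_opt: "(- g $ i - d $ i) * (0 - d $ i) \<le> 0" for i
    using closest_point_box_component[of I F "x $ i" i "x - g"] I F x xI
    by (auto simp: d algebra_simps)
  have v_self: "(- g $ i - v $ i) * (0 - v $ i) \<le> 0" for i
    using v_opt[of i 0] xJ[of i] by simp
  have "(v $ i)\<^sup>2 \<le> - (g $ i * v $ i)" for i
    using v_self[of i] by (simp add: algebra_simps power2_eq_square)
  then have "(\<Sum>i\<in>UNIV. (v $ i)\<^sup>2) \<le> (\<Sum>i\<in>UNIV. - (g $ i * v $ i))"
    by (intro sum_mono)
  then show "lin_step F x g \<Delta> \<bullet> lin_step F x g \<Delta> \<le> - (g \<bullet> lin_step F x g \<Delta>)"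
    unfolding v_def[symmetric] by (simp add: inner_vec_def sum_negf power2_eq_square)
  have "closest_point F (x - g) \<in> F"
    using I F x by (intro closest_point_in_set) (auto intro: closed_product_box)
  then have dI: "x $ i + d $ i \<in> I i" for i
    by (simp add: F d)
  have "x $ i + \<theta> i * d $ i \<in> I i" for i
  proof -
    have "(1 - \<theta> i) *\<^sub>R (x $ i) + \<theta> i *\<^sub>R (x $ i + d $ i) \<in> I i"
      using I(2)[of i] \<theta>(1,2)[of i] xI[of i] dI[of i] by (intro convexD) auto
    then show ?thesis
      by (simp add: algebra_simps)
  qed
  moreover have "\<bar>\<theta> i * d $ i\<bar> \<le> \<Delta> $ i" for i
    using \<theta>(1,3)[of i] by (simp add: abs_mult)
  ultimately have "x $ i + \<theta> i * d $ i \<in> J i" for i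
    by (simp add: J_def abs_le_iff) (smt (verit))
  then have "\<theta> i * (d $ i)\<^sup>2 \<le> - g $ i * v $ i" for i
    using clipped_step_decrease[OF \<theta>(1,2) d_opt v_self v_opt] by blast
  then have "(\<Sum>i\<in>UNIV. \<theta> i * (d $ i)\<^sup>2) \<le> (\<Sum>i\<in>UNIV. - g $ i * v $ i)"
    by (intro sum_mono)
  then show "(\<Sum>i\<in>UNIV. \<theta> i * (d $ i)\<^sup>2) \<le> - (g \<bullet> lin_step F x g \<Delta>)"
    unfolding v_def[symmetric] by (simp add: inner_vec_def sum_negf)
qed

lemma abs_quadratic_form_le:
  fixes A :: "real^'n::finite^'n"
  assumes "onorm ((*v) A) \<le> \<kappa>"
  shows "\<bar>v \<bullet> (A *v v)\<bar> \<le> \<kappa> * (norm v)\<^sup>2"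
proof -
  have "\<bar>v \<bullet> (A *v v)\<bar> \<le> norm v * norm (A *v v)"
    by (rule Cauchy_Schwarz_ineq2)
  also have "\<dots> \<le> norm v * (onorm ((*v) A) * norm v)"
    by (intro mult_left_mono onorm) auto
  also have "\<dots> \<le> norm v * (\<kappa> * norm v)"
    using assms by (intro mult_left_mono mult_right_mono) auto
  finally show ?thesis
    by (simp add: power2_eq_square mult_ac)
qed

text \<open>If the model has no minimiser on the ray through \<open>v\<close> or attains it beyond \<open>v\<close>, the full step is taken and keeps at least half of the
linear decrease \<open>p = - (g \<bullet> v)\<close>. Otherwise the minimum along the ray has value \<open>- p\<^sup>2 / (2 q)\<close>, where
the curvature \<open>q\<close> is at most \<open>\<kappa> (v \<bullet> v) \<le> \<kappa> p\<close>.\<close>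

lemma quad_step_decrease:
  fixes g v :: "real^'n::finite"
  assumes A: "onorm ((*v) A) \<le> \<kappa>" and "1 \<le> \<kappa>" and v: "v \<bullet> v \<le> - (g \<bullet> v)"
  shows "quad_model g A (quad_step g A v) \<le> (g \<bullet> v) / (2 * \<kappa>)"
proof -
  define p where "p = - (g \<bullet> v)"
  define q where "q = v \<bullet> (A *v v)"
  have "0 \<le> p"
    unfolding p_def using inner_ge_zero v by (rule order_trans)
  have "q \<le> \<kappa> * (v \<bullet> v)"
    using abs_quadratic_form_le[OF A, of v] by (simp add: q_def power2_norm_eq_inner)
  also have "\<dots> \<le> \<kappa> * p"
    unfolding p_def using v \<open>1 \<le> \<kappa>\<close> by (intro mult_left_mono) auto
  finally have q: "q \<le> \<kappa> * p" .
  have model: "quad_model g A (c *\<^sub>R v) = - c * p + c\<^sup>2 * q / 2" for c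
    by (simp add: quad_model_def p_def q_def matrix_vector_mult_scaleR power2_eq_square)
  have half: "p / (2 * \<kappa>) \<le> p / 2"
    using \<open>0 \<le> p\<close> \<open>1 \<le> \<kappa>\<close> by (intro divide_left_mono) auto
  show ?thesis
  proof (cases "p < q")
    case True
    then have "0 < q"
      using \<open>0 \<le> p\<close> by simp
    have "quad_model g A (quad_step g A v) = - (p / q) * p + (p / q)\<^sup>2 * q / 2"
      using True \<open>0 < q\<close> unfolding quad_step_def step_scaling_def model
      by (simp add: p_def q_def min_def field_simps)
    also have "\<dots> = - (p\<^sup>2 / (2 * q))"
      using \<open>0 < q\<close> by (simp add: field_simps power2_eq_square)
    also have "\<dots> \<le> - (p / (2 * \<kappa>))"
    proof -
      have "p * q \<le> p * (\<kappa> * p)"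
        using q \<open>0 \<le> p\<close> by (rule mult_left_mono)
      then have "p / (2 * \<kappa>) \<le> p\<^sup>2 / (2 * q)"
        using \<open>0 < q\<close> \<open>1 \<le> \<kappa>\<close> by (simp add: field_simps power2_eq_square)
      then show ?thesis
        by simp
    qed
    finally show ?thesis
      by (simp add: p_def)
  next
    case False
    then have "step_scaling g A v = 1"
      by (simp add: step_scaling_def p_def[symmetric] q_def[symmetric] min_def field_simps)
    then have "quad_model g A (quad_step g A v) = - p + q / 2"
      unfolding quad_step_def model by simp
    also have "\<dots> \<le> - (p / (2 * \<kappa>))"
      using False half by simp
    finally show ?thesis
      by (simp add: p_def)
  qed
qed

section \<open>Functions with Lipschitz continuous gradient\<close>

lemma lipschitz_gradient_upper_bound:
  fixes f :: "'a::real_inner \<Rightarrow> real"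
  assumes grad: "\<And>y. GDERIV f y :> gradf y"
    and lip: "\<And>y z. norm (gradf y - gradf z) \<le> L * norm (y - z)"
  shows "f (x + s) \<le> f x + gradf x \<bullet> s + L / 2 * (norm s)\<^sup>2"
proof -
  define \<phi> where "\<phi> t = f (x + t *\<^sub>R s) - t * (gradf x \<bullet> s) - L / 2 * t\<^sup>2 * (norm s)\<^sup>2" for t
  have "\<phi> 1 \<le> \<phi> 0"
  proof (rule DERIV_nonpos_imp_nonincreasing[where f = \<phi>])
    fix t :: real
    assume t: "0 \<le> t" "t \<le> 1"
    have "((\<lambda>t. f (x + t *\<^sub>R s)) has_derivative (\<lambda>h. (h *\<^sub>R s) \<bullet> gradf (x + t *\<^sub>R s))) (at t)"
      by (rule has_derivative_compose[of "\<lambda>t. x + t *\<^sub>R s" "\<lambda>h. h *\<^sub>R s", 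
            OF _ grad[unfolded gderiv_def, of "x + t *\<^sub>R s"]])
        (auto intro!: derivative_eq_intros)
    then have "((\<lambda>t. f (x + t *\<^sub>R s)) has_real_derivative (gradf (x + t *\<^sub>R s) \<bullet> s)) (at t)"
      by (rule has_derivative_imp_has_field_derivative) (simp add: inner_commute)
    then have "(\<phi> has_real_derivative
        (gradf (x + t *\<^sub>R s) \<bullet> s - gradf x \<bullet> s - L * t * (norm s)\<^sup>2)) (at t)"
      unfolding \<phi>_def by (auto intro!: derivative_eq_intros)
    moreover have "gradf (x + t *\<^sub>R s) \<bullet> s - gradf x \<bullet> s \<le> L * t * (norm s)\<^sup>2"
    proof -
      have "gradf (x + t *\<^sub>R s) \<bullet> s - gradf x \<bullet> s \<le> norm (gradf (x + t *\<^sub>R s) - gradf x) * norm s"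
        unfolding inner_diff_left[symmetric] by (rule norm_cauchy_schwarz)
      also have "\<dots> \<le> (L * norm (t *\<^sub>R s)) * norm s"
        using lip[of "x + t *\<^sub>R s" x] by (intro mult_right_mono) auto
      finally show ?thesis
        using t by (simp add: power2_eq_square mult_ac)
    qed
    ultimately show "\<exists>y. (\<phi> has_real_derivative y) (at t) \<and> y \<le> 0"
      by (intro exI[of _ "gradf (x + t *\<^sub>R s) \<bullet> s - gradf x \<bullet> s - L * t * (norm s)\<^sup>2"]) simp
  qed simp
  then show ?thesis
    by (simp add: \<phi>_def)
qed

section \<open>Scalar inequalities for Adagrad weights\<close>

text \<open>The sum is a lower Riemann sum of \<open>1 / t\<close>: each term is at most the increment of \<open>ln\<close> over the
interval by which \<open>a j\<close> extends the partial sums.\<close>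

lemma sum_ratio_le_ln:
  fixes a :: "nat \<Rightarrow> real"
  assumes "0 < \<sigma>" and "\<And>j. 0 \<le> a j"
  shows "(\<Sum>j\<le>k. a j / (\<sigma> + (\<Sum>i\<le>j. a i))) \<le> ln ((\<sigma> + (\<Sum>i\<le>k. a i)) / \<sigma>)"
proof -
  have step: "r / (p + r) \<le> ln (p + r) - ln p" if "0 < p" "0 \<le> r" for p r :: real
    using ln_le_minus_one[of "p / (p + r)"] that by (simp add: ln_div field_simps)
  have pos: "0 < \<sigma> + (\<Sum>i\<le>k. a i)" for k
    using assms by (intro add_pos_nonneg sum_nonneg) auto
  have "(\<Sum>j\<le>k. a j / (\<sigma> + (\<Sum>i\<le>j. a i))) \<le> ln (\<sigma> + (\<Sum>i\<le>k. a i)) - ln \<sigma>"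
  proof (induction k)
    case 0
    then show ?case
      using step[of \<sigma> "a 0"] assms by simp
  next
    case (Suc k)
    then show ?case
      using step[OF pos[of k] assms(2)[of "Suc k"]] by (simp add: add.assoc)
  qed
  then show ?thesis
    using pos[of k] assms(1) by (subst ln_div) auto
qed

text \<open>Half of the linear term absorbs the logarithm. The additive constant comes from the tangent to \<open>ln\<close>
whose slope times \<open>b\<close> is \<open>a / 2\<close>, that is, the tangent at \<open>2 b / a\<close>; the term \<open>a / y\<close> is at most \<open>a\<close>.\<close>

lemma linear_minus_log_lower_bound:
  fixes a b y :: real
  assumes "0 < a" "0 < b" "1 \<le> y"
  shows "a / 2 * y \<le> a * (y - 1 / y) - b * ln y + a + b * (ln (2 * b / a) - 1)"
proof -
  have "ln (a * y / (2 * b)) \<le> a * y / (2 * b) - 1"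
    using assms by (intro ln_le_minus_one) auto
  moreover have "ln (a * y / (2 * b)) = ln y - ln (2 * b / a)"
    using assms by (simp add: ln_div ln_mult)
  ultimately have "ln y - ln (2 * b / a) \<le> a * y / (2 * b) - 1"
    by simp
  then have "b * (ln y - ln (2 * b / a)) \<le> b * (a * y / (2 * b) - 1)"
    using assms by (intro mult_left_mono) auto
  also have "\<dots> = a * y / 2 - b"
    using assms by (simp add: field_simps)
  finally have "b * ln y \<le> a * y / 2 - b + b * ln (2 * b / a)"
    by (simp add: algebra_simps)
  moreover have "a * (1 / y) \<le> a"
    using assms by (simp add: field_simps)
  ultimately show ?thesis
    by (simp add: algebra_simps)
qed

section \<open>One realisation of the algorithm\<close>

text \<open>The feasible set is kept as an arbitrary product of closed intervals, so that intervals with infinite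
endpoints need no separate treatment.\<close>

locale adagb2_realisation =
  fixes I :: "'n::finite \<Rightarrow> real set"
    and F :: "(real^'n) set"
    and \<sigma> \<tau> \<kappa>\<^sub>s \<kappa>\<^sub>B :: real
    and x_ini :: "real^'n"
    and x g d w \<Delta> s :: "nat \<Rightarrow> real^'n"
    and B :: "nat \<Rightarrow> real^'n^'n"
  assumes I: "\<And>i. closed (I i)" "\<And>i. convex (I i)"
    and F: "F = {y. \<forall>i. y $ i \<in> I i}" "F \<noteq> {}"
    and constants: "0 < \<sigma>" "\<sigma> \<le> 1" "0 < \<tau>" "0 \<le> \<kappa>\<^sub>s" "1 \<le> \<kappa>\<^sub>B"
    and run: "adagb2_run F \<sigma> \<tau> \<kappa>\<^sub>s x_ini x g d w \<Delta> B s"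
    and hessian: "\<And>k. onorm ((*v) (B k)) \<le> \<kappa>\<^sub>B"
begin

lemma x_0: "x 0 = closest_point F x_ini"
  and d_eq: "d k = closest_point F (x k - g k) - x k"
  and w_eq: "w k $ i = sqrt ((prev_weight \<sigma> w k $ i)\<^sup>2 + (d k $ i)\<^sup>2)"
  and \<Delta>_eq: "\<Delta> k $ i = \<bar>d k $ i\<bar> / w k $ i"
  and feasible_step: "x k + s k \<in> F"
  and s_bound: "\<bar>s k $ i\<bar> \<le> \<kappa>\<^sub>s * \<Delta> k $ i"
  and sufficient_decrease: "quad_model (g k) (B k) (s k)
          \<le> \<tau> * quad_model (g k) (B k) (quad_step (g k) (B k) (lin_step F (x k) (g k) (\<Delta> k)))"
  and x_Suc: "x (Suc k) = x k + s k"
  using run unfolding adagb2_run_def by blast+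

lemma closed_F: "closed F" and convex_F: "convex F"
  unfolding F(1) using I by (auto intro: closed_product_box convex_product_box)

lemma x_feasible: "x k \<in> F"
proof (cases k)
  case 0
  then show ?thesis
    using closest_point_in_set[OF closed_F F(2)] x_0 by simp
next
  case (Suc j)
  then show ?thesis
    using feasible_step x_Suc by simp
qed

lemma w_square: "(w k $ i)\<^sup>2 = \<sigma> + (\<Sum>j\<le>k. (d j $ i)\<^sup>2)"
proof (induction k)
  case 0
  then show ?case
    using constants by (simp add: w_eq prev_weight_def)
next
  case (Suc k)
  have "(w (Suc k) $ i)\<^sup>2 = (w k $ i)\<^sup>2 + (d (Suc k) $ i)\<^sup>2"
    by (simp add: w_eq[of "Suc k"] prev_weight_def)
  with Suc show ?case
    by simp
qed

lemma w_nonneg: "0 \<le> w k $ i"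
  by (simp add: w_eq)

lemma w_lower: "sqrt \<sigma> \<le> w k $ i"
proof (rule real_le_lsqrt)
  show "\<sigma> \<le> (w k $ i)\<^sup>2"
    by (simp add: w_square sum_nonneg)
qed (use constants w_nonneg in auto)

lemma w_pos: "0 < w k $ i"
  using w_lower[of k i] constants(1) real_sqrt_gt_zero[of \<sigma>] by linarith

lemma abs_d_le_w: "\<bar>d k $ i\<bar> \<le> w k $ i"
  using w_eq[of k i] by (simp add: real_le_rsqrt)

lemma \<Delta>_nonneg: "0 \<le> \<Delta> k $ i"
  using w_nonneg by (simp add: \<Delta>_eq)

lemma \<Delta>_le_1: "\<Delta> k $ i \<le> 1"
  using w_pos[of k i] abs_d_le_w[of k i] by (simp add: \<Delta>_eq)

lemma norm_d_le: "norm (d k) \<le> norm (g k)"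
proof -
  have "dist (closest_point F (x k - g k)) (closest_point F (x k)) \<le> dist (x k - g k) (x k)"
    by (intro closest_point_lipschitz convex_F closed_F F)
  then show ?thesis
    using closest_point_self[OF x_feasible] by (simp add: d_eq dist_norm)
qed

lemma norm_s_le: "norm (s k) \<le> \<kappa>\<^sub>s * CARD('n)"
proof -
  have "norm (s k) \<le> (\<Sum>i\<in>UNIV. \<bar>s k $ i\<bar>)"
    by (rule norm_le_l1_cart)
  also have "\<dots> \<le> (\<Sum>i\<in>(UNIV :: 'n set). \<kappa>\<^sub>s)"
    using s_bound \<Delta>_le_1 constants
    by (intro sum_mono) (meson mult_left_le order_trans)
  finally show ?thesis
    by (simp add: mult.commute)
qed

lemma norm_x_le: "norm (x k) \<le> norm (closest_point F x_ini) + k * (\<kappa>\<^sub>s * CARD('n))"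
proof (induction k)
  case 0
  then show ?case
    by (simp add: x_0)
next
  case (Suc k)
  have "norm (x (Suc k)) \<le> norm (x k) + norm (s k)"
    unfolding x_Suc by (rule norm_triangle_ineq)
  then show ?case
    using Suc norm_s_le[of k] by (simp add: algebra_simps)
qed

lemma norm_s_square_le: "(norm (s k))\<^sup>2 \<le> \<kappa>\<^sub>s\<^sup>2 * (\<Sum>i\<in>UNIV. (d k $ i)\<^sup>2 / (w k $ i)\<^sup>2)"
proof -
  have "(s k $ i)\<^sup>2 \<le> \<kappa>\<^sub>s\<^sup>2 * ((d k $ i)\<^sup>2 / (w k $ i)\<^sup>2)" for i
    using power_mono[OF s_bound[of k i] abs_ge_zero, of 2]
    by (simp add: \<Delta>_eq power_mult_distrib power_divide)
  then show ?thesis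
    unfolding power2_norm_eq_inner inner_vec_def sum_distrib_left
    by (intro sum_mono) (simp add: power2_eq_square)
qed

text \<open>The fraction \<open>\<surd>\<sigma> / w\<close> of \<open>d\<close> is at most \<open>1\<close> because the weights start at \<open>\<surd>\<sigma>\<close>, and it fits into
the trust region of radius \<open>\<bar>d\<bar> / w\<close> because \<open>\<sigma> \<le> 1\<close>.\<close>

lemma model_decrease:
  "quad_model (g k) (B k) (s k)
     \<le> - (\<tau> * sqrt \<sigma> / (2 * \<kappa>\<^sub>B)) * (\<Sum>i\<in>UNIV. (d k $ i)\<^sup>2 / w k $ i)"
proof -
  let ?v = "lin_step F (x k) (g k) (\<Delta> k)"
  let ?S = "\<Sum>i\<in>UNIV. (d k $ i)\<^sup>2 / w k $ i"
  have "sqrt \<sigma> / w k $ i \<le> 1" for i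
    using w_lower[of k i] w_pos[of k i] by simp
  moreover have "sqrt \<sigma> / w k $ i * \<bar>d k $ i\<bar> \<le> \<Delta> k $ i" for i
    using constants w_pos[of k i]
    by (simp add: \<Delta>_eq divide_right_mono mult_left_le_one_le)
  moreover have "0 \<le> sqrt \<sigma> / w k $ i" for i
    using constants w_pos[of k i] by simp
  ultimately have v: "?v \<bullet> ?v \<le> - (g k \<bullet> ?v)"
    "(\<Sum>i\<in>UNIV. sqrt \<sigma> / w k $ i * (d k $ i)\<^sup>2) \<le> - (g k \<bullet> ?v)"
    using lin_step_decrease[OF I F(1) x_feasible \<Delta>_nonneg d_eq, of "\<lambda>i. sqrt \<sigma> / w k $ i"]
    by blast+
  have "quad_model (g k) (B k) (s k) \<le> \<tau> * quad_model (g k) (B k) (quad_step (g k) (B k) ?v)"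
    by (rule sufficient_decrease)
  also have "\<dots> \<le> \<tau> * ((g k \<bullet> ?v) / (2 * \<kappa>\<^sub>B))"
    using constants by (intro mult_left_mono quad_step_decrease hessian v) auto
  also have "\<dots> \<le> \<tau> * (- (sqrt \<sigma> * ?S) / (2 * \<kappa>\<^sub>B))"
    using constants v(2) by (intro mult_left_mono divide_right_mono) (auto simp: sum_distrib_left)
  finally show ?thesis
    by (simp add: field_simps)
qed

text \<open>The objective is compared with the model by adding and subtracting \<open>g\<close> in the first-order term and
the quadratic form of \<open>B\<close> in the second-order term.\<close>

lemma objective_decrease:
  assumes "\<And>y. GDERIV f y :> gradf y"
    and "\<And>y z. norm (gradf y - gradf z) \<le> L * norm (y - z)"
  shows "f (x (Suc k)) \<le> f (x k) - \<tau> * sqrt \<sigma> / (2 * \<kappa>\<^sub>B) * (\<Sum>i\<in>UNIV. (d k $ i)\<^sup>2 / w k $ i)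
           + \<bar>(gradf (x k) - g k) \<bullet> s k\<bar> + (\<kappa>\<^sub>B + L) / 2 * (norm (s k))\<^sup>2"
proof -
  have "f (x (Suc k)) \<le> f (x k) + gradf (x k) \<bullet> s k + L / 2 * (norm (s k))\<^sup>2"
    unfolding x_Suc by (rule lipschitz_gradient_upper_bound[OF assms])
  moreover have "gradf (x k) \<bullet> s k = quad_model (g k) (B k) (s k)
      + (gradf (x k) - g k) \<bullet> s k - (1/2) * (s k \<bullet> (B k *v s k))"
    by (simp add: quad_model_def inner_diff_left)
  moreover have "- (s k \<bullet> (B k *v s k)) \<le> \<kappa>\<^sub>B * (norm (s k))\<^sup>2"
    using abs_quadratic_form_le[OF hessian[of k], of "s k"] by linarith
  moreover have "(\<kappa>\<^sub>B + L) / 2 * (norm (s k))\<^sup>2 = (1/2) * (\<kappa>\<^sub>B * (norm (s k))\<^sup>2) + L / 2 * (norm (s k))\<^sup>2"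
    by (simp add: field_simps)
  moreover have "quad_model (g k) (B k) (s k)
      \<le> - (\<tau> * sqrt \<sigma> / (2 * \<kappa>\<^sub>B) * (\<Sum>i\<in>UNIV. (d k $ i)\<^sup>2 / w k $ i))"
    using model_decrease[of k] by (simp only: mult_minus_left)
  ultimately show ?thesis
    using abs_ge_self[of "(gradf (x k) - g k) \<bullet> s k"] by argo
qed

text \<open>The two sums on the right are those that telescoping the decrease of the objective controls, and for
\<open>\<kappa> = \<kappa>\<^sub>*\<close> they enter with the same coefficients. The logarithm has been eliminated at this point, so
taking expectations requires only linearity.\<close>

lemma norm_d_sum_bound:
  fixes \<kappa> :: real
  assumes "0 < \<kappa>"
  defines "a \<equiv> \<tau> * \<sigma> / (2 * \<kappa>\<^sub>B)" and "b \<equiv> 2 * CARD('n) * \<kappa>"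
  shows "a / 2 * (\<Sum>j\<le>k. norm (d j)) \<le> sqrt (real (k + 1)) *
     (\<tau> * sqrt \<sigma> / (2 * \<kappa>\<^sub>B) * (\<Sum>j\<le>k. \<Sum>i\<in>UNIV. (d j $ i)\<^sup>2 / w j $ i)
      - \<kappa> * (\<Sum>j\<le>k. \<Sum>i\<in>UNIV. (d j $ i)\<^sup>2 / (w j $ i)\<^sup>2) + a + b * (ln (2 * b / a) - 1))"
proof -
  define D where "D = (\<Sum>j\<le>k. (norm (d j))\<^sup>2)"
  define y where "y = sqrt (1 + D / \<sigma>)"
  have D: "D = (\<Sum>j\<le>k. \<Sum>i\<in>UNIV. (d j $ i)\<^sup>2)"
    unfolding D_def power2_norm_eq_inner inner_vec_def by (simp add: power2_eq_square)
  have "0 \<le> D"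
    by (simp add: D_def sum_nonneg)
  have "1 \<le> y"
    using \<open>0 \<le> D\<close> constants by (simp add: y_def)
  have y2: "y\<^sup>2 = 1 + D / \<sigma>"
    using \<open>0 \<le> D\<close> constants by (simp add: y_def)
  have ab: "0 < a" "0 < b"
    using constants assms(1) by (simp_all add: a_def b_def)
  have sqrt_D: "sqrt (\<sigma> + D) = sqrt \<sigma> * y"
    using constants by (simp add: y_def real_sqrt_mult[symmetric] field_simps)
  have coordinate: "(\<Sum>l\<le>j. (d l $ i)\<^sup>2) \<le> D" if "j \<le> k" for i j
  proof -
    have "(\<Sum>l\<le>j. (d l $ i)\<^sup>2) \<le> (\<Sum>l\<le>k. (d l $ i)\<^sup>2)"
      using that by (intro sum_mono2) auto
    also have "\<dots> \<le> D"
      unfolding D by (intro sum_mono member_le_sum) auto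
    finally show ?thesis .
  qed
  have "w j $ i \<le> sqrt \<sigma> * y" if "j \<le> k" for i j
    unfolding sqrt_D[symmetric]
    using coordinate[OF that] by (intro real_le_rsqrt) (simp add: w_square)
  then have "(\<Sum>j\<le>k. \<Sum>i\<in>UNIV. (d j $ i)\<^sup>2 / (sqrt \<sigma> * y)) \<le> (\<Sum>j\<le>k. \<Sum>i\<in>UNIV. (d j $ i)\<^sup>2 / w j $ i)"
    using w_pos constants \<open>1 \<le> y\<close> by (intro sum_mono divide_left_mono mult_pos_pos) auto
  then have "D / (sqrt \<sigma> * y) \<le> (\<Sum>j\<le>k. \<Sum>i\<in>UNIV. (d j $ i)\<^sup>2 / w j $ i)"
    by (simp add: D sum_divide_distrib)
  then have "\<tau> * sqrt \<sigma> / (2 * \<kappa>\<^sub>B) * (D / (sqrt \<sigma> * y))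
      \<le> \<tau> * sqrt \<sigma> / (2 * \<kappa>\<^sub>B) * (\<Sum>j\<le>k. \<Sum>i\<in>UNIV. (d j $ i)\<^sup>2 / w j $ i)"
    using constants by (intro mult_left_mono) auto
  moreover have "\<tau> * sqrt \<sigma> / (2 * \<kappa>\<^sub>B) * (D / (sqrt \<sigma> * y)) = a * (y - 1 / y)"
  proof -
    have "D = \<sigma> * (y\<^sup>2 - 1)"
      using y2 constants by simp
    then have "D / (sqrt \<sigma> * y) = sqrt \<sigma> * (y - 1 / y)"
      using constants \<open>1 \<le> y\<close> by (simp add: field_simps power2_eq_square)
    then show ?thesis
      using constants by (simp add: a_def)
  qed
  ultimately have first: "a * (y - 1 / y)
      \<le> \<tau> * sqrt \<sigma> / (2 * \<kappa>\<^sub>B) * (\<Sum>j\<le>k. \<Sum>i\<in>UNIV. (d j $ i)\<^sup>2 / w j $ i)"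
    by simp
  have "(\<Sum>j\<le>k. (d j $ i)\<^sup>2 / (w j $ i)\<^sup>2) \<le> 2 * ln y" for i
  proof -
    have "(\<Sum>j\<le>k. (d j $ i)\<^sup>2 / (w j $ i)\<^sup>2) \<le> ln ((\<sigma> + (\<Sum>j\<le>k. (d j $ i)\<^sup>2)) / \<sigma>)"
      unfolding w_square using constants by (intro sum_ratio_le_ln) auto
    also have "\<dots> \<le> ln (y\<^sup>2)"
      using constants coordinate[of k i]
      by (intro ln_mono) (auto simp: y2 field_simps intro!: add_pos_nonneg sum_nonneg)
    finally show ?thesis
      using \<open>1 \<le> y\<close> by (simp add: ln_realpow)
  qed
  then have "(\<Sum>i\<in>UNIV. \<Sum>j\<le>k. (d j $ i)\<^sup>2 / (w j $ i)\<^sup>2) \<le> (\<Sum>i\<in>(UNIV :: 'n set). 2 * ln y)"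
    by (intro sum_mono)
  then have "(\<Sum>j\<le>k. \<Sum>i\<in>UNIV. (d j $ i)\<^sup>2 / (w j $ i)\<^sup>2) \<le> CARD('n) * (2 * ln y)"
    by (subst sum.swap) simp
  then have "\<kappa> * (\<Sum>j\<le>k. \<Sum>i\<in>UNIV. (d j $ i)\<^sup>2 / (w j $ i)\<^sup>2) \<le> \<kappa> * (CARD('n) * (2 * ln y))"
    using assms(1) by (intro mult_left_mono) auto
  then have second: "\<kappa> * (\<Sum>j\<le>k. \<Sum>i\<in>UNIV. (d j $ i)\<^sup>2 / (w j $ i)\<^sup>2) \<le> b * ln y"
    by (simp add: b_def mult_ac)
  \<comment> \<open>Cauchy-Schwarz, and then \<open>D \<le> y\<^sup>2\<close>, which uses \<open>\<sigma> \<le> 1\<close>.\<close>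
  have "(\<Sum>j\<le>k. norm (d j)) \<le> sqrt (D * (k + 1))"
    using sum_squared_le_sum_of_squares[of "\<lambda>j. norm (d j)" "{..k}"]
    by (intro real_le_rsqrt) (simp add: D_def add.commute)
  also have "\<dots> \<le> sqrt (y\<^sup>2 * (k + 1))"
  proof -
    have "\<sigma> * D \<le> \<sigma> + D"
      using constants \<open>0 \<le> D\<close> by (simp add: add_increasing mult_left_le_one_le)
    then have "D \<le> y\<^sup>2"
      using constants by (simp add: y2 field_simps)
    then show ?thesis
      by (intro real_sqrt_le_mono mult_right_mono) auto
  qed
  also have "\<dots> = sqrt (k + 1) * y"
    using \<open>1 \<le> y\<close> by (simp add: real_sqrt_mult)
  finally have "a / 2 * (\<Sum>j\<le>k. norm (d j)) \<le> a / 2 * (sqrt (k + 1) * y)"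
    using ab by (intro mult_left_mono) auto
  also have "\<dots> = sqrt (k + 1) * (a / 2 * y)"
    by simp
  also have "\<dots> \<le> sqrt (k + 1) *
     (\<tau> * sqrt \<sigma> / (2 * \<kappa>\<^sub>B) * (\<Sum>j\<le>k. \<Sum>i\<in>UNIV. (d j $ i)\<^sup>2 / w j $ i)
      - \<kappa> * (\<Sum>j\<le>k. \<Sum>i\<in>UNIV. (d j $ i)\<^sup>2 / (w j $ i)\<^sup>2) + a + b * (ln (2 * b / a) - 1))"
  proof (rule mult_left_mono)
    show "a / 2 * y \<le> \<tau> * sqrt \<sigma> / (2 * \<kappa>\<^sub>B) * (\<Sum>j\<le>k. \<Sum>i\<in>UNIV. (d j $ i)\<^sup>2 / w j $ i)
      - \<kappa> * (\<Sum>j\<le>k. \<Sum>i\<in>UNIV. (d j $ i)\<^sup>2 / (w j $ i)\<^sup>2) + a + b * (ln (2 * b / a) - 1)"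
      using linear_minus_log_lower_bound[OF ab \<open>1 \<le> y\<close>] first second by linarith
  qed simp
  finally show ?thesis .
qed

end


section \<open>Expectations along the random process\<close>

locale adagb2_process = prob_space M
  for M :: "'a measure" +
  fixes I :: "'n::finite \<Rightarrow> real set"
    and F :: "(real^'n) set"
    and \<sigma> \<tau> \<kappa>\<^sub>s \<kappa>\<^sub>B L :: real
    and x_ini :: "real^'n"
    and x g d w \<Delta> s :: "nat \<Rightarrow> 'a \<Rightarrow> real^'n"
    and B :: "nat \<Rightarrow> 'a \<Rightarrow> real^'n^'n"
    and f :: "real^'n \<Rightarrow> real" and gradf :: "real^'n \<Rightarrow> real^'n"
  assumes meas [measurable]:
      "\<And>k. x k \<in> borel_measurable M" "\<And>k. d k \<in> borel_measurable M"
      "\<And>k. w k \<in> borel_measurable M" "\<And>k. s k \<in> borel_measurable M"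
    and g_integrable: "\<And>k. integrable M (g k)"
    and realisation: "AE \<omega> in M. adagb2_realisation I F \<sigma> \<tau> \<kappa>\<^sub>s \<kappa>\<^sub>B x_ini
          (\<lambda>k. x k \<omega>) (\<lambda>k. g k \<omega>) (\<lambda>k. d k \<omega>) (\<lambda>k. w k \<omega>) (\<lambda>k. \<Delta> k \<omega>) (\<lambda>k. s k \<omega>) (\<lambda>k. B k \<omega>)"
    and gradient: "\<And>y. GDERIV f y :> gradf y"
    and lipschitz: "0 \<le> L" "\<And>y z. norm (gradf y - gradf z) \<le> L * norm (y - z)"
begin

lemma parameters: "0 < \<sigma>" "\<sigma> \<le> 1" "0 < \<tau>" "0 \<le> \<kappa>\<^sub>s" "1 \<le> \<kappa>\<^sub>B"
  and closed_F: "closed F" and convex_F: "convex F" and F_nonempty: "F \<noteq> {}"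
proof -
  obtain \<omega> where "adagb2_realisation I F \<sigma> \<tau> \<kappa>\<^sub>s \<kappa>\<^sub>B x_ini
          (\<lambda>k. x k \<omega>) (\<lambda>k. g k \<omega>) (\<lambda>k. d k \<omega>) (\<lambda>k. w k \<omega>) (\<lambda>k. \<Delta> k \<omega>) (\<lambda>k. s k \<omega>) (\<lambda>k. B k \<omega>)"
    using eventually_happens'[OF ae_filter_bot realisation] ..
  then interpret adagb2_realisation I F \<sigma> \<tau> \<kappa>\<^sub>s \<kappa>\<^sub>B x_ini
    "\<lambda>k. x k \<omega>" "\<lambda>k. g k \<omega>" "\<lambda>k. d k \<omega>" "\<lambda>k. w k \<omega>" "\<lambda>k. \<Delta> k \<omega>" "\<lambda>k. s k \<omega>" "\<lambda>k. B k \<omega>" .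
  show "0 < \<sigma>" "\<sigma> \<le> 1" "0 < \<tau>" "0 \<le> \<kappa>\<^sub>s" "1 \<le> \<kappa>\<^sub>B" "closed F" "convex F" "F \<noteq> {}"
    using constants closed_F convex_F F(2) by auto
qed

lemma g_measurable [measurable]: "g k \<in> borel_measurable M"
  using g_integrable by (rule borel_measurable_integrable)

lemma component_measurable [measurable]:
  "(\<lambda>\<omega>. d k \<omega> $ i) \<in> borel_measurable M" "(\<lambda>\<omega>. w k \<omega> $ i) \<in> borel_measurable M"
proof -
  have [measurable]: "(\<lambda>v :: real^'n. v $ i) \<in> borel_measurable borel"
    by (intro borel_measurable_continuous_onI continuous_intros)
  show "(\<lambda>\<omega>. d k \<omega> $ i) \<in> borel_measurable M" "(\<lambda>\<omega>. w k \<omega> $ i) \<in> borel_measurable M"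
    by measurable
qed

lemma continuous_f: "continuous_on UNIV f"
  using gradient unfolding gderiv_def continuous_on_eq_continuous_at[OF open_UNIV]
  by (blast intro: has_derivative_continuous)

lemma continuous_gradf: "continuous_on UNIV gradf"
proof (rule lipschitz_on_continuous_on)
  show "L-lipschitz_on UNIV gradf"
    using lipschitz by (auto simp: lipschitz_on_def dist_norm)
qed

lemma f_measurable [measurable]: "f \<in> borel_measurable borel"
  and gradf_measurable [measurable]: "gradf \<in> borel_measurable borel"
  using continuous_f continuous_gradf by (auto intro: borel_measurable_continuous_onI)

text \<open>The start is deterministic and every step is bounded by the trust region, so each iterate stays
in a fixed ball. This makes the objective and the gradient integrable along the process.\<close>

lemma AE_bounded_along_iterates:
  fixes h :: "real^'n \<Rightarrow> 'b::real_normed_vector"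
  assumes "continuous_on UNIV h"
  obtains C where "AE \<omega> in M. norm (h (x k \<omega>)) \<le> C"
proof -
  define R where "R = norm (closest_point F x_ini) + k * (\<kappa>\<^sub>s * CARD('n))"
  have "bounded (h ` cball 0 R)"
    by (intro compact_imp_bounded compact_continuous_image compact_cball
        continuous_on_subset[OF assms]) auto
  then obtain C where "\<forall>z\<in>h ` cball 0 R. norm z \<le> C"
    unfolding bounded_iff ..
  then have C: "norm (h y) \<le> C" if "y \<in> cball 0 R" for y
    using that by blast
  have "AE \<omega> in M. norm (h (x k \<omega>)) \<le> C"
    using realisation
  proof eventually_elim
    case (elim \<omega>)
    then show ?case
      using adagb2_realisation.norm_x_le[OF elim, of k] by (intro C) (simp add: R_def)
  qed
  then show thesis ..
qed

lemma f_x_integrable: "integrable M (\<lambda>\<omega>. f (x k \<omega>))"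
proof -
  obtain C where "AE \<omega> in M. norm (f (x k \<omega>)) \<le> C"
    by (rule AE_bounded_along_iterates[OF continuous_f])
  then show ?thesis
    by (rule integrable_const_bound) measurable
qed

lemma error_integrable: "integrable M (\<lambda>\<omega>. norm (g k \<omega> - gradf (x k \<omega>)))"
proof -
  obtain C where "AE \<omega> in M. norm (gradf (x k \<omega>)) \<le> C"
    by (rule AE_bounded_along_iterates[OF continuous_gradf])
  then have "integrable M (\<lambda>\<omega>. gradf (x k \<omega>))"
    by (rule integrable_const_bound) measurable
  then show ?thesis
    using g_integrable by (intro integrable_norm Bochner_Integration.integrable_diff)
qed

lemma norm_d_integrable: "integrable M (\<lambda>\<omega>. norm (d k \<omega>))"
proof (rule Bochner_Integration.integrable_bound)
  show "integrable M (\<lambda>\<omega>. norm (g k \<omega>))"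
    using g_integrable by (rule integrable_norm)
  show "AE \<omega> in M. norm (norm (d k \<omega>)) \<le> norm (norm (g k \<omega>))"
    using realisation
  proof eventually_elim
    case (elim \<omega>)
    then show ?case
      using adagb2_realisation.norm_d_le[OF elim, of k] by simp
  qed
qed measurable

lemma norm_s_square_integrable: "integrable M (\<lambda>\<omega>. (norm (s k \<omega>))\<^sup>2)"
proof (rule integrable_const_bound)
  show "AE \<omega> in M. norm ((norm (s k \<omega>))\<^sup>2) \<le> (\<kappa>\<^sub>s * CARD('n))\<^sup>2"
    using realisation
  proof eventually_elim
    case (elim \<omega>)
    then show ?case
      using adagb2_realisation.norm_s_le[OF elim, of k] by (simp add: power_mono)
  qed
qed measurable

lemma error_inner_s_integrable:
  "integrable M (\<lambda>\<omega>. \<bar>(gradf (x k \<omega>) - g k \<omega>) \<bullet> s k \<omega>\<bar>)"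
proof (rule Bochner_Integration.integrable_bound)
  show "integrable M (\<lambda>\<omega>. norm (g k \<omega> - gradf (x k \<omega>)) * (\<kappa>\<^sub>s * CARD('n)))"
    using error_integrable by (rule integrable_mult_left)
  show "AE \<omega> in M. norm \<bar>(gradf (x k \<omega>) - g k \<omega>) \<bullet> s k \<omega>\<bar>
      \<le> norm (norm (g k \<omega> - gradf (x k \<omega>)) * (\<kappa>\<^sub>s * CARD('n)))"
    using realisation
  proof eventually_elim
    case (elim \<omega>)
    have "\<bar>(gradf (x k \<omega>) - g k \<omega>) \<bullet> s k \<omega>\<bar> \<le> norm (gradf (x k \<omega>) - g k \<omega>) * norm (s k \<omega>)"
      by (rule Cauchy_Schwarz_ineq2)
    also have "\<dots> \<le> norm (g k \<omega> - gradf (x k \<omega>)) * (\<kappa>\<^sub>s * CARD('n))"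
      using adagb2_realisation.norm_s_le[OF elim, of k]
      by (simp add: norm_minus_commute mult_left_mono)
    finally show ?case
      using parameters by simp
  qed
qed measurable

text \<open>Each term is at most \<open>\<bar>d $ i\<bar>\<close>, because \<open>\<bar>d $ i\<bar> \<le> w $ i\<close>.\<close>

lemma decrease_integrable: "integrable M (\<lambda>\<omega>. \<Sum>i\<in>UNIV. (d k \<omega> $ i)\<^sup>2 / w k \<omega> $ i)"
proof (rule Bochner_Integration.integrable_sum)
  fix i :: 'n
  show "integrable M (\<lambda>\<omega>. (d k \<omega> $ i)\<^sup>2 / w k \<omega> $ i)"
  proof (rule Bochner_Integration.integrable_bound[OF norm_d_integrable[of k]])
    show "AE \<omega> in M. norm ((d k \<omega> $ i)\<^sup>2 / w k \<omega> $ i) \<le> norm (norm (d k \<omega>))"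
      using realisation
    proof eventually_elim
      case (elim \<omega>)
      have w: "0 < w k \<omega> $ i" "\<bar>d k \<omega> $ i\<bar> \<le> w k \<omega> $ i"
        using adagb2_realisation.w_pos[OF elim] adagb2_realisation.abs_d_le_w[OF elim] by auto
      have "(d k \<omega> $ i)\<^sup>2 = \<bar>d k \<omega> $ i\<bar> * \<bar>d k \<omega> $ i\<bar>"
        by (simp add: power2_eq_square)
      also have "\<dots> \<le> norm (d k \<omega>) * w k \<omega> $ i"
        using w component_le_norm_cart[of "d k \<omega>" i] by (intro mult_mono) auto
      finally show ?case
        using w by (simp add: field_simps)
    qed
  qed measurable
qed

lemma second_order_integrable: "integrable M (\<lambda>\<omega>. \<Sum>i\<in>UNIV. (d k \<omega> $ i)\<^sup>2 / (w k \<omega> $ i)\<^sup>2)"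
proof (rule Bochner_Integration.integrable_sum)
  fix i :: 'n
  show "integrable M (\<lambda>\<omega>. (d k \<omega> $ i)\<^sup>2 / (w k \<omega> $ i)\<^sup>2)"
  proof (rule integrable_const_bound)
    show "AE \<omega> in M. norm ((d k \<omega> $ i)\<^sup>2 / (w k \<omega> $ i)\<^sup>2) \<le> 1"
      using realisation
    proof eventually_elim
      case (elim \<omega>)
      have "\<bar>d k \<omega> $ i / w k \<omega> $ i\<bar> \<le> 1"
        using adagb2_realisation.w_pos[OF elim, of k i] adagb2_realisation.abs_d_le_w[OF elim, of k i]
        by simp
      then show ?case
        by (simp add: abs_square_le_1 flip: power_divide)
    qed
  qed measurable
qed

lemma expected_objective_decrease:
  assumes error: "(\<integral>\<omega>. \<bar>(gradf (x k \<omega>) - g k \<omega>) \<bullet> s k \<omega>\<bar> \<partial>M)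
                    \<le> \<kappa>\<^sup>2 * (\<integral>\<omega>. (norm (s k \<omega>))\<^sup>2 \<partial>M)"
  shows "(\<integral>\<omega>. f (x (Suc k) \<omega>) \<partial>M)
      \<le> (\<integral>\<omega>. f (x k \<omega>) \<partial>M)
         - \<tau> * sqrt \<sigma> / (2 * \<kappa>\<^sub>B) * (\<integral>\<omega>. (\<Sum>i\<in>UNIV. (d k \<omega> $ i)\<^sup>2 / w k \<omega> $ i) \<partial>M)
         + \<kappa>\<^sub>s\<^sup>2 * (\<kappa>\<^sup>2 + (1/2) * (\<kappa>\<^sub>B + L))
             * (\<integral>\<omega>. (\<Sum>i\<in>UNIV. (d k \<omega> $ i)\<^sup>2 / (w k \<omega> $ i)\<^sup>2) \<partial>M)"
proof -
  define c where "c = \<tau> * sqrt \<sigma> / (2 * \<kappa>\<^sub>B)"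
  define S where "S = (\<integral>\<omega>. (norm (s k \<omega>))\<^sup>2 \<partial>M)"
  define Q where "Q = (\<integral>\<omega>. (\<Sum>i\<in>UNIV. (d k \<omega> $ i)\<^sup>2 / (w k \<omega> $ i)\<^sup>2) \<partial>M)"
  note [simp] = f_x_integrable decrease_integrable error_inner_s_integrable
    norm_s_square_integrable second_order_integrable
  have "(\<integral>\<omega>. f (x (Suc k) \<omega>) \<partial>M) \<le> (\<integral>\<omega>. f (x k \<omega>)
         - c * (\<Sum>i\<in>UNIV. (d k \<omega> $ i)\<^sup>2 / w k \<omega> $ i)
         + \<bar>(gradf (x k \<omega>) - g k \<omega>) \<bullet> s k \<omega>\<bar> + (\<kappa>\<^sub>B + L) / 2 * (norm (s k \<omega>))\<^sup>2 \<partial>M)"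
  proof (rule integral_mono_AE)
    show "AE \<omega> in M. f (x (Suc k) \<omega>) \<le> f (x k \<omega>)
         - c * (\<Sum>i\<in>UNIV. (d k \<omega> $ i)\<^sup>2 / w k \<omega> $ i)
         + \<bar>(gradf (x k \<omega>) - g k \<omega>) \<bullet> s k \<omega>\<bar> + (\<kappa>\<^sub>B + L) / 2 * (norm (s k \<omega>))\<^sup>2"
      using realisation unfolding c_def
      by eventually_elim (rule adagb2_realisation.objective_decrease[OF _ gradient lipschitz(2)])
  qed (auto intro!: Bochner_Integration.integrable_add Bochner_Integration.integrable_diff)
  also have "\<dots> = (\<integral>\<omega>. f (x k \<omega>) \<partial>M)
         - c * (\<integral>\<omega>. (\<Sum>i\<in>UNIV. (d k \<omega> $ i)\<^sup>2 / w k \<omega> $ i) \<partial>M)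
         + (\<integral>\<omega>. \<bar>(gradf (x k \<omega>) - g k \<omega>) \<bullet> s k \<omega>\<bar> \<partial>M) + (\<kappa>\<^sub>B + L) / 2 * S"
    by (simp add: S_def)
  finally have step: "(\<integral>\<omega>. f (x (Suc k) \<omega>) \<partial>M) \<le> (\<integral>\<omega>. f (x k \<omega>) \<partial>M)
         - c * (\<integral>\<omega>. (\<Sum>i\<in>UNIV. (d k \<omega> $ i)\<^sup>2 / w k \<omega> $ i) \<partial>M)
         + (\<kappa>\<^sup>2 + (1/2) * (\<kappa>\<^sub>B + L)) * S"
    using error by (simp add: S_def algebra_simps)
  have "S \<le> (\<integral>\<omega>. \<kappa>\<^sub>s\<^sup>2 * (\<Sum>i\<in>UNIV. (d k \<omega> $ i)\<^sup>2 / (w k \<omega> $ i)\<^sup>2) \<partial>M)"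
    unfolding S_def
  proof (rule integral_mono_AE)
    show "AE \<omega> in M. (norm (s k \<omega>))\<^sup>2 \<le> \<kappa>\<^sub>s\<^sup>2 * (\<Sum>i\<in>UNIV. (d k \<omega> $ i)\<^sup>2 / (w k \<omega> $ i)\<^sup>2)"
      using realisation by eventually_elim (rule adagb2_realisation.norm_s_square_le)
  qed auto
  also have "\<dots> = \<kappa>\<^sub>s\<^sup>2 * Q"
    by (simp add: Q_def)
  finally have "(\<kappa>\<^sup>2 + (1/2) * (\<kappa>\<^sub>B + L)) * S \<le> (\<kappa>\<^sup>2 + (1/2) * (\<kappa>\<^sub>B + L)) * (\<kappa>\<^sub>s\<^sup>2 * Q)"
    using parameters lipschitz by (intro mult_left_mono) auto
  then have "(\<kappa>\<^sup>2 + (1/2) * (\<kappa>\<^sub>B + L)) * S \<le> \<kappa>\<^sub>s\<^sup>2 * (\<kappa>\<^sup>2 + (1/2) * (\<kappa>\<^sub>B + L)) * Q"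
    by (simp only: mult.assoc mult.left_commute)
  with step show ?thesis
    unfolding c_def Q_def by linarith
qed

text \<open>Telescoping the expected decrease bounds the right-hand side of the pathwise inequality
\<open>norm_d_sum_bound\<close> by the total decrease available to the objective.\<close>

lemma sum_expected_norm_d:
  fixes \<kappa> :: real
  assumes error: "\<And>j. (\<integral>\<omega>. \<bar>(gradf (x j \<omega>) - g j \<omega>) \<bullet> s j \<omega>\<bar> \<partial>M)
                    \<le> \<kappa>\<^sup>2 * (\<integral>\<omega>. (norm (s j \<omega>))\<^sup>2 \<partial>M)"
    and lower: "\<And>y. y \<in> F \<Longrightarrow> f_low \<le> f y"
    and "0 < \<kappa>\<^sub>s"
  defines "a \<equiv> \<tau> * \<sigma> / (2 * \<kappa>\<^sub>B)"
    and "b \<equiv> 2 * CARD('n) * (\<kappa>\<^sub>s\<^sup>2 * (\<kappa>\<^sup>2 + (1/2) * (\<kappa>\<^sub>B + L)))"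
  shows "(\<Sum>j\<le>k. \<integral>\<omega>. norm (d j \<omega>) \<partial>M)
     \<le> sqrt (real (k + 1)) * (2 / a * (f (closest_point F x_ini) - f_low + a + b * (ln (2 * b / a) - 1)))"
proof -
  define c where "c = \<tau> * sqrt \<sigma> / (2 * \<kappa>\<^sub>B)"
  define \<kappa>' where "\<kappa>' = \<kappa>\<^sub>s\<^sup>2 * (\<kappa>\<^sup>2 + (1/2) * (\<kappa>\<^sub>B + L))"
  define K where "K = a + b * (ln (2 * b / a) - 1)"
  define P where "P j \<omega> = (\<Sum>i\<in>UNIV. (d j \<omega> $ i)\<^sup>2 / w j \<omega> $ i)" for j \<omega>
  define Q where "Q j \<omega> = (\<Sum>i\<in>UNIV. (d j \<omega> $ i)\<^sup>2 / (w j \<omega> $ i)\<^sup>2)" for j \<omega>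
  have [simp]: "integrable M (P j)" "integrable M (Q j)" for j
    unfolding P_def[abs_def] Q_def[abs_def] by (rule decrease_integrable second_order_integrable)+
  have "0 < a"
    using parameters by (simp add: a_def)
  have "0 < \<kappa>'"
    using parameters lipschitz assms(3) by (simp add: \<kappa>'_def add_nonneg_pos)
  have b: "b = 2 * CARD('n) * \<kappa>'"
    by (simp add: b_def \<kappa>'_def)
  have "(\<integral>\<omega>. f (x 0 \<omega>) \<partial>M) = (\<integral>\<omega>. f (closest_point F x_ini) \<partial>M)"
  proof (rule integral_cong_AE)
    show "AE \<omega> in M. f (x 0 \<omega>) = f (closest_point F x_ini)"
      using realisation by eventually_elim (auto dest: adagb2_realisation.x_0)
  qed measurable
  then have start: "(\<integral>\<omega>. f (x 0 \<omega>) \<partial>M) = f (closest_point F x_ini)"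
    by (simp add: prob_space)
  have telescope: "(\<integral>\<omega>. f (x k \<omega>) \<partial>M) \<le> f (closest_point F x_ini)
      - c * (\<Sum>j<k. \<integral>\<omega>. P j \<omega> \<partial>M) + \<kappa>' * (\<Sum>j<k. \<integral>\<omega>. Q j \<omega> \<partial>M)" for k
  proof (induction k)
    case 0
    then show ?case
      using start by simp
  next
    case (Suc k)
    then show ?case
      using expected_objective_decrease[OF error, of k]
      by (simp add: P_def Q_def c_def \<kappa>'_def algebra_simps)
  qed
  have "(\<integral>\<omega>. f_low \<partial>M) \<le> (\<integral>\<omega>. f (x (Suc k) \<omega>) \<partial>M)"
  proof (rule integral_mono_AE)
    show "AE \<omega> in M. f_low \<le> f (x (Suc k) \<omega>)"
      using realisation by eventually_elim (intro lower adagb2_realisation.x_feasible)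
  qed (simp_all add: f_x_integrable)
  then have balance: "c * (\<Sum>j\<le>k. \<integral>\<omega>. P j \<omega> \<partial>M) - \<kappa>' * (\<Sum>j\<le>k. \<integral>\<omega>. Q j \<omega> \<partial>M)
      \<le> f (closest_point F x_ini) - f_low"
    using telescope[of "Suc k"] by (simp add: prob_space lessThan_Suc_atMost)
  have "a / 2 * (\<Sum>j\<le>k. \<integral>\<omega>. norm (d j \<omega>) \<partial>M) = (\<integral>\<omega>. a / 2 * (\<Sum>j\<le>k. norm (d j \<omega>)) \<partial>M)"
    by (simp add: norm_d_integrable)
  also have "\<dots> \<le> (\<integral>\<omega>. sqrt (k + 1) * (c * (\<Sum>j\<le>k. P j \<omega>) - \<kappa>' * (\<Sum>j\<le>k. Q j \<omega>) + K) \<partial>M)"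
  proof (rule integral_mono_AE)
    show "AE \<omega> in M. a / 2 * (\<Sum>j\<le>k. norm (d j \<omega>))
        \<le> sqrt (k + 1) * (c * (\<Sum>j\<le>k. P j \<omega>) - \<kappa>' * (\<Sum>j\<le>k. Q j \<omega>) + K)"
      using realisation
    proof eventually_elim
      case (elim \<omega>)
      show ?case
        using adagb2_realisation.norm_d_sum_bound[OF elim \<open>0 < \<kappa>'\<close>, of k]
        by (simp add: P_def Q_def c_def K_def a_def b algebra_simps)
    qed
  qed (simp_all add: norm_d_integrable)
  also have "\<dots> = sqrt (k + 1) *
      (c * (\<Sum>j\<le>k. \<integral>\<omega>. P j \<omega> \<partial>M) - \<kappa>' * (\<Sum>j\<le>k. \<integral>\<omega>. Q j \<omega> \<partial>M) + K)"
    by (simp add: prob_space)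
  also have "\<dots> \<le> sqrt (k + 1) * (f (closest_point F x_ini) - f_low + K)"
    using balance by (intro mult_left_mono) auto
  finally have "2 / a * (a / 2 * (\<Sum>j\<le>k. \<integral>\<omega>. norm (d j \<omega>) \<partial>M))
      \<le> 2 / a * (sqrt (real (k + 1)) * (f (closest_point F x_ini) - f_low + K))"
    using \<open>0 < a\<close> by (intro mult_left_mono) auto
  also have "\<dots> = sqrt (real (k + 1)) * (2 / a * (f (closest_point F x_ini) - f_low + K))"
    by (rule mult.left_commute)
  finally show ?thesis
    using \<open>0 < a\<close> by (simp add: K_def add.assoc)
qed

text \<open>Exact and approximate criticality measure are displacements from the same point to projections of
points at distance \<open>\<parallel>g - G\<parallel>\<close>, and the projection is nonexpansive.\<close>

lemma expected_criticality_le: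
  "(\<integral>\<omega>. norm (closest_point F (x k \<omega> - gradf (x k \<omega>)) - x k \<omega>) \<partial>M)
     \<le> (\<integral>\<omega>. norm (d k \<omega>) \<partial>M) + (\<integral>\<omega>. norm (g k \<omega> - gradf (x k \<omega>)) \<partial>M)"
proof -
  have [measurable]: "closest_point F \<in> borel_measurable borel"
    by (intro borel_measurable_continuous_onI continuous_on_closest_point convex_F closed_F F_nonempty)
  have bound: "AE \<omega> in M. norm (closest_point F (x k \<omega> - gradf (x k \<omega>)) - x k \<omega>)
      \<le> norm (d k \<omega>) + norm (g k \<omega> - gradf (x k \<omega>))"
    using realisation
  proof eventually_elim
    case (elim \<omega>)
    have "dist (closest_point F (x k \<omega> - gradf (x k \<omega>))) (closest_point F (x k \<omega> - g k \<omega>))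
        \<le> dist (x k \<omega> - gradf (x k \<omega>)) (x k \<omega> - g k \<omega>)"
      by (intro closest_point_lipschitz convex_F closed_F F_nonempty)
    moreover have eq: "closest_point F (x k \<omega> - gradf (x k \<omega>)) - x k \<omega>
        = (closest_point F (x k \<omega> - gradf (x k \<omega>)) - closest_point F (x k \<omega> - g k \<omega>)) + d k \<omega>"
      using adagb2_realisation.d_eq[OF elim, of k] by simp
    ultimately show ?case
      unfolding eq using norm_triangle_ineq[of
          "closest_point F (x k \<omega> - gradf (x k \<omega>)) - closest_point F (x k \<omega> - g k \<omega>)" "d k \<omega>"]
      by (simp add: dist_norm)
  qed
  have sum: "integrable M (\<lambda>\<omega>. norm (d k \<omega>) + norm (g k \<omega> - gradf (x k \<omega>)))"
    by (intro Bochner_Integration.integrable_add norm_d_integrable error_integrable)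
  have "integrable M (\<lambda>\<omega>. norm (closest_point F (x k \<omega> - gradf (x k \<omega>)) - x k \<omega>))"
  proof (rule Bochner_Integration.integrable_bound[OF sum])
    show "AE \<omega> in M. norm (norm (closest_point F (x k \<omega> - gradf (x k \<omega>)) - x k \<omega>))
        \<le> norm (norm (d k \<omega>) + norm (g k \<omega> - gradf (x k \<omega>)))"
      using bound by eventually_elim simp
  qed measurable
  from integral_mono_AE[OF this sum bound] show ?thesis
    by (simp add: norm_d_integrable error_integrable)
qed

end

section \<open>Conditioning on the past\<close>

lemma subalgebra_past:
  assumes "\<And>k. g k \<in> borel_measurable M"
  shows "subalgebra M (past M g k)"
proof -
  have gen: "(\<Union>j<k. {g j -` A \<inter> space M | A. A \<in> sets borel}) \<subseteq> sets M"
    using assms by (auto intro: measurable_sets)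
  then have "(\<Union>j<k. {g j -` A \<inter> space M | A. A \<in> sets borel}) \<subseteq> Pow (space M)"
    using sets.sets_into_space by blast
  with gen show ?thesis
    by (auto simp: subalgebra_def past_def sets_measure_of space_measure_of
        intro!: sets.sigma_sets_subset subsetD[OF sets.sigma_sets_subset])
qed

lemma (in prob_space) sigma_finite_subalgebra_past:
  assumes "\<And>k. g k \<in> borel_measurable M"
  shows "sigma_finite_subalgebra M (past M g k)"
proof -
  interpret finite_measure_subalgebra M "past M g k"
    by unfold_locales (rule subalgebra_past[OF assms])
  show ?thesis
    by unfold_locales
qed

text \<open>Integrating both sides removes the conditioning, by the tower property.\<close>

lemma (in sigma_finite_subalgebra) integral_le_of_real_cond_exp_le:
  assumes "integrable M u" "integrable M v"
    and "AE \<omega> in M. real_cond_exp M F u \<omega> \<le> c * real_cond_exp M F v \<omega>"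
  shows "(\<integral>\<omega>. u \<omega> \<partial>M) \<le> c * (\<integral>\<omega>. v \<omega> \<partial>M)"
proof -
  have "(\<integral>\<omega>. real_cond_exp M F u \<omega> \<partial>M) \<le> (\<integral>\<omega>. c * real_cond_exp M F v \<omega> \<partial>M)"
    using assms by (intro integral_mono_AE) (auto simp: real_cond_exp_int)
  then show ?thesis
    using assms by (simp add: real_cond_exp_int)
qed

section \<open>The convergence constant\<close>

text \<open>The left-hand side is what the argument yields, and the right-hand side is larger because \<open>\<sigma> \<le> 1\<close>
and \<open>a \<le> 1\<close>. Enlarging the factor in front of the bracket is legitimate only if the bracket is
nonnegative; this holds since the argument of the logarithm is at least \<open>4\<close>, hence at least \<open>e\<close>.\<close>

lemma convergence_constant_bound:
  fixes n \<kappa> \<kappa>\<^sub>B \<sigma> \<tau> \<Gamma> :: real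
  assumes "0 < \<sigma>" "\<sigma> \<le> 1" "0 < \<tau>" "\<tau> \<le> 1" "1 \<le> \<kappa>\<^sub>B" "0 \<le> \<Gamma>" "1 \<le> n" "1 / 2 \<le> \<kappa>"
  defines "a \<equiv> \<tau> * \<sigma> / (2 * \<kappa>\<^sub>B)" and "b \<equiv> 2 * n * \<kappa>"
  shows "2 / a * (\<Gamma> + a + b * (ln (2 * b / a) - 1))
     \<le> 4 * \<kappa>\<^sub>B / (\<tau> * \<sigma>\<^sup>2) *
          (1 + \<Gamma> + 2 * n * \<kappa> * (ln (8 * n * \<kappa> * \<kappa>\<^sub>B / (\<tau> * \<sigma> powr (5/2))) - 1))"
proof -
  define q where "q = 8 * n * \<kappa> * \<kappa>\<^sub>B / (\<tau> * \<sigma> powr (5/2))"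
  have "0 < a"
    using assms(1-5) by (simp add: a_def)
  have "a \<le> 1"
  proof -
    have "\<tau> * \<sigma> \<le> 1 * 1"
      using assms(1-4) by (intro mult_mono) auto
    then show ?thesis
      using assms(5) by (simp add: a_def)
  qed
  have "1 * (1 / 2) \<le> n * \<kappa>"
    using assms(7,8) by (intro mult_mono) auto
  then have "1 \<le> b"
    by (simp add: b_def)
  have ratio: "2 * b / a = 8 * n * \<kappa> * \<kappa>\<^sub>B / (\<tau> * \<sigma>)"
    using assms(1,3,5) by (simp add: a_def b_def field_simps)
  have "\<sigma> powr (5/2) \<le> \<sigma> powr 1"
    using assms(1,2) by (intro powr_mono') auto
  then have "2 * b / a \<le> q"
    unfolding ratio q_def using assms by (intro divide_left_mono mult_left_mono) auto
  have four: "4 \<le> 2 * b / a"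
  proof -
    have "1 * 1 \<le> b * \<kappa>\<^sub>B"
      using \<open>1 \<le> b\<close> assms(5) by (intro mult_mono) auto
    moreover have "\<tau> * \<sigma> \<le> 1 * 1"
      using assms(1-4) by (intro mult_mono) auto
    ultimately have "4 * (\<tau> * \<sigma>) \<le> 4 * (b * \<kappa>\<^sub>B)"
      by simp
    then show ?thesis
      unfolding ratio using assms(1,3) by (simp add: b_def field_simps)
  qed
  have "1 = ln (exp 1 :: real)"
    by simp
  also have "\<dots> \<le> ln (2 * b / a)"
    using exp_le four by (subst ln_le_cancel_iff) auto
  finally have log1: "1 \<le> ln (2 * b / a)" .
  have log2: "ln (2 * b / a) \<le> ln q"
    using four \<open>2 * b / a \<le> q\<close> by (intro ln_mono) auto
  have "2 / a * (\<Gamma> + a + b * (ln (2 * b / a) - 1)) \<le> 2 / a * (1 + \<Gamma> + b * (ln q - 1))"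
  proof (rule mult_left_mono)
    have "b * (ln (2 * b / a) - 1) \<le> b * (ln q - 1)"
      using log2 \<open>1 \<le> b\<close> by (intro mult_left_mono) auto
    then show "\<Gamma> + a + b * (ln (2 * b / a) - 1) \<le> 1 + \<Gamma> + b * (ln q - 1)"
      using \<open>a \<le> 1\<close> by linarith
  qed (use \<open>0 < a\<close> in simp)
  also have "\<dots> \<le> 4 * \<kappa>\<^sub>B / (\<tau> * \<sigma>\<^sup>2) * (1 + \<Gamma> + b * (ln q - 1))"
  proof (rule mult_right_mono)
    have "\<sigma>\<^sup>2 \<le> \<sigma>"
      using assms(1,2) by (simp add: power2_eq_square mult_left_le_one_le)
    then have "4 * \<kappa>\<^sub>B / (\<tau> * \<sigma>) \<le> 4 * \<kappa>\<^sub>B / (\<tau> * \<sigma>\<^sup>2)"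
      using assms(1,3,5) by (intro divide_left_mono mult_left_mono) auto
    then show "2 / a \<le> 4 * \<kappa>\<^sub>B / (\<tau> * \<sigma>\<^sup>2)"
      by (simp add: a_def)
    show "0 \<le> 1 + \<Gamma> + b * (ln q - 1)"
      using assms(6) \<open>1 \<le> b\<close> log1 log2 by (intro add_nonneg_nonneg mult_nonneg_nonneg) auto
  qed
  finally show ?thesis
    by (simp add: b_def q_def)
qed

section \<open>Rate of convergence\<close>

text \<open>The four cases enter only through a bound of the form
\<open>E \<parallel>\<Xi>\<^sub>j\<parallel> \<le> \<kappa>\<^sub>1 E \<parallel>d\<^sub>j\<parallel> + \<kappa>\<^sub>2 E \<parallel>g\<^sub>j - G\<^sub>j\<parallel> + \<kappa>\<^sub>3\<close>, which is averaged over the iterations; dividing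
\<open>(\<Sum>j\<le>k. E \<parallel>d\<^sub>j\<parallel>) \<le> \<surd>(k + 1) \<kappa>_conv\<close> by \<open>k + 1\<close> produces the rate.\<close>

theorem theorem4p2:
  fixes M :: "'a measure"
    and f :: "real^'n::finite \<Rightarrow> real"
    and gradf :: "real^'n \<Rightarrow> real^'n"
    and D F :: "(real^'n) set"
    and l u :: "ereal^'n"
    and x_ini :: "real^'n"
    and x g d w \<Delta> s G \<Xi> :: "nat \<Rightarrow> 'a \<Rightarrow> real^'n"
    and B :: "nat \<Rightarrow> 'a \<Rightarrow> real^'n^'n"
    and \<sigma> \<tau> \<kappa>\<^sub>s L \<kappa>\<^sub>B f_low \<kappa>\<^sub>G\<^sub>g n \<Gamma>\<^sub>0 \<kappa>_star \<kappa>_conv \<kappa>\<^sub>1 \<kappa>\<^sub>2 \<kappa>\<^sub>3 :: real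
  assumes "prob_space M"
    and n: "n = real CARD('n)"
    and F: "F = {y. \<forall>i. l $ i \<le> ereal (y $ i) \<and> ereal (y $ i) \<le> u $ i}"
    and constants: "0 < \<sigma>" "\<sigma> \<le> 1" "0 < \<tau>" "\<tau> \<le> 1" "1 \<le> \<kappa>\<^sub>s"
    and measurability:
      "\<And>k. x k \<in> borel_measurable M" "\<And>k. g k \<in> borel_measurable M"
      "\<And>k. d k \<in> borel_measurable M" "\<And>k. w k \<in> borel_measurable M"
      "\<And>k. \<Delta> k \<in> borel_measurable M" "\<And>k. B k \<in> borel_measurable M"
      "\<And>k. s k \<in> borel_measurable M"
    and determined: "\<And>k. x k \<in> borel_measurable (past M g k)"
    and integrability: "\<And>k. integrable M (g k)"
    and algorithm: "AE \<omega> in M. adagb2_run F \<sigma> \<tau> \<kappa>\<^sub>s x_ini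
          (\<lambda>k. x k \<omega>) (\<lambda>k. g k \<omega>) (\<lambda>k. d k \<omega>) (\<lambda>k. w k \<omega>) (\<lambda>k. \<Delta> k \<omega>) (\<lambda>k. B k \<omega>) (\<lambda>k. s k \<omega>)"
    and gradient: "\<And>y. GDERIV f y :> gradf y"
    and G: "\<And>k \<omega>. G k \<omega> = gradf (x k \<omega>)"
    and \<Xi>: "\<And>k \<omega>. \<Xi> k \<omega> = closest_point F (x k \<omega> - G k \<omega>) - x k \<omega>"
    and hyp1: "open D" "F \<subseteq> D" "twice_cont_diff_on f D" "F \<noteq> {}"
    and hyp2: "0 \<le> L" "\<And>y z. norm (gradf y - gradf z) \<le> L * norm (y - z)"
    and hyp3: "1 \<le> \<kappa>\<^sub>B" "AE \<omega> in M. \<forall>k. onorm ((*v) (B k \<omega>)) \<le> \<kappa>\<^sub>B"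
    and hyp4: "f_low < f (closest_point F x_ini)" "\<And>y. y \<in> F \<Longrightarrow> f_low \<le> f y"
    and hyp5: "0 < \<kappa>\<^sub>G\<^sub>g"
      "\<And>k. AE \<omega> in M. cond_exp_past M g k (\<lambda>\<omega>. \<bar>(G k \<omega> - g k \<omega>) \<bullet> s k \<omega>\<bar>) \<omega>
                 \<le> \<kappa>\<^sub>G\<^sub>g\<^sup>2 * cond_exp_past M g k (\<lambda>\<omega>. (norm (s k \<omega>))\<^sup>2) \<omega>"
    and \<Gamma>\<^sub>0: "\<Gamma>\<^sub>0 = f (closest_point F x_ini) - f_low"
    and \<kappa>_star: "\<kappa>_star = \<kappa>\<^sub>s\<^sup>2 * (\<kappa>\<^sub>G\<^sub>g\<^sup>2 + (1/2) * (\<kappa>\<^sub>B + L))"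
    and \<kappa>_conv: "\<kappa>_conv = 4 * \<kappa>\<^sub>B / (\<tau> * \<sigma>\<^sup>2) *
          (1 + \<Gamma>\<^sub>0 + 2 * n * \<kappa>_star * (ln (8 * n * \<kappa>_star * \<kappa>\<^sub>B / (\<tau> * \<sigma> powr (5/2))) - 1))"
    and cases:
      "\<comment> \<open>(a) coherently distributed\<close>
       (\<exists>\<kappa>_opt>0.
          (\<forall>k. (\<integral>\<omega>. norm (\<Xi> k \<omega>) \<partial>M) \<le> \<kappa>_opt * (\<integral>\<omega>. norm (d k \<omega>) \<partial>M)) \<and>
          \<kappa>\<^sub>1 = \<kappa>_opt \<and> \<kappa>\<^sub>2 = 0 \<and> \<kappa>\<^sub>3 = 0)
       \<or> \<comment> \<open>(b) controlled error\<close>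
       (\<exists>\<kappa>_err1>0.
          (\<forall>k. AE \<omega> in M. cond_exp_past M g k (\<lambda>\<omega>. norm (g k \<omega> - G k \<omega>)) \<omega>
                    \<le> \<kappa>_err1 * cond_exp_past M g k (\<lambda>\<omega>. norm (d k \<omega>)) \<omega>) \<and>
          \<kappa>\<^sub>1 = 1 + \<kappa>_err1 \<and> \<kappa>\<^sub>2 = 0 \<and> \<kappa>\<^sub>3 = 0)
       \<or> \<comment> \<open>(c) probabilistic error control\<close>
       (\<exists>p \<kappa>_err2 \<kappa>_pec. 0 < p \<and> p < 1 \<and> 0 \<le> \<kappa>_err2 \<and> 0 \<le> \<kappa>_pec \<and>
          (\<forall>k. AE \<omega> in M. norm (g k \<omega> - G k \<omega>) < \<kappa>_err2) \<and>
          (\<forall>k. AE \<omega> in M. p \<le> cond_prob_past M g k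
                 {\<omega> \<in> space M. norm (g k \<omega> - G k \<omega>) \<le> \<kappa>_pec * norm (d k \<omega>)} \<omega>) \<and>
          \<kappa>\<^sub>1 = 1 + \<kappa>_pec \<and> \<kappa>\<^sub>2 = 0 \<and> \<kappa>\<^sub>3 = (1 - p) * \<kappa>_err2)
       \<or> \<comment> \<open>(d) general\<close>
       (\<kappa>\<^sub>1 = 1 \<and> \<kappa>\<^sub>2 = 1 \<and> \<kappa>\<^sub>3 = 0)"
  shows "\<forall>k. 1 / real (k + 1) * (\<Sum>j=0..k. \<integral>\<omega>. norm (\<Xi> j \<omega>) \<partial>M)
            \<le> \<kappa>_conv * \<kappa>\<^sub>1 / sqrt (real (k + 1))
              + \<kappa>\<^sub>2 * (1 / real (k + 1) * (\<Sum>j=0..k. \<integral>\<omega>. norm (g j \<omega> - G j \<omega>) \<partial>M))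
              + \<kappa>\<^sub>3"
proof
  fix k :: nat
  \<comment> \<open>A box with possibly infinite bounds, seen as a product of closed real intervals.\<close>
  define I where "I i = {t. l $ i \<le> ereal t \<and> ereal t \<le> u $ i}" for i
  have real: "AE \<omega> in M. adagb2_realisation I F \<sigma> \<tau> \<kappa>\<^sub>s \<kappa>\<^sub>B x_ini
        (\<lambda>k. x k \<omega>) (\<lambda>k. g k \<omega>) (\<lambda>k. d k \<omega>) (\<lambda>k. w k \<omega>) (\<lambda>k. \<Delta> k \<omega>) (\<lambda>k. s k \<omega>) (\<lambda>k. B k \<omega>)"
    using algorithm hyp3(2)
  proof eventually_elim
    case (elim \<omega>)
    then show ?case
      using constants hyp1(4) hyp3(1)
      by unfold_locales
        (auto simp: I_def F intro: closed_ereal_interval convex_ereal_interval)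
  qed
  interpret prob_space M by fact
  interpret adagb2_process M I F \<sigma> \<tau> \<kappa>\<^sub>s \<kappa>\<^sub>B L x_ini x g d w \<Delta> s B f gradf
    using measurability integrability real gradient hyp2 by unfold_locales auto
  interpret past: sigma_finite_subalgebra M "past M g j" for j
    by (rule sigma_finite_subalgebra_past) (rule measurability(2))

  have "\<And>j. (\<integral>\<omega>. \<bar>(gradf (x j \<omega>) - g j \<omega>) \<bullet> s j \<omega>\<bar> \<partial>M)
          \<le> \<kappa>\<^sub>G\<^sub>g\<^sup>2 * (\<integral>\<omega>. (norm (s j \<omega>))\<^sup>2 \<partial>M)"
    using hyp5(2) unfolding G
    by (intro past.integral_le_of_real_cond_exp_le error_inner_s_integrable norm_s_square_integrable)
  from sum_expected_norm_d[OF this hyp4(2), of k]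
  have "(\<Sum>j\<le>k. \<integral>\<omega>. norm (d j \<omega>) \<partial>M)
     \<le> sqrt (k + 1) * (2 / (\<tau> * \<sigma> / (2 * \<kappa>\<^sub>B)) * (\<Gamma>\<^sub>0 + \<tau> * \<sigma> / (2 * \<kappa>\<^sub>B)
         + 2 * n * \<kappa>_star * (ln (2 * (2 * n * \<kappa>_star) / (\<tau> * \<sigma> / (2 * \<kappa>\<^sub>B))) - 1)))"
    using constants(5) by (simp add: n \<kappa>_star \<Gamma>\<^sub>0 add.commute)
  also have "\<dots> \<le> sqrt (k + 1) * \<kappa>_conv"
    unfolding \<kappa>_conv
  proof (intro mult_left_mono convergence_constant_bound)
    have "1 \<le> \<kappa>\<^sub>s\<^sup>2"
      using constants(5) by (rule one_le_power)
    moreover have "1 / 2 \<le> \<kappa>\<^sub>G\<^sub>g\<^sup>2 + (1/2) * (\<kappa>\<^sub>B + L)"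
      using hyp2(1) hyp3(1) by (intro add_increasing) auto
    ultimately have "1 * (1 / 2) \<le> \<kappa>_star"
      unfolding \<kappa>_star by (intro mult_mono) auto
    then show "1 / 2 \<le> \<kappa>_star"
      by simp
    have "1 \<le> CARD('n)"
      by (simp add: Suc_leI)
    then show "1 \<le> n"
      by (simp add: n)
  qed (use constants hyp3(1) hyp4(1) \<Gamma>\<^sub>0 in auto)
  finally have d_sum: "(\<Sum>j\<le>k. \<integral>\<omega>. norm (d j \<omega>) \<partial>M) \<le> sqrt (k + 1) * \<kappa>_conv" .

  have general: "(\<integral>\<omega>. norm (\<Xi> j \<omega>) \<partial>M)
      \<le> (\<integral>\<omega>. norm (d j \<omega>) \<partial>M) + (\<integral>\<omega>. norm (g j \<omega> - G j \<omega>) \<partial>M)" for j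
    unfolding \<Xi> G by (rule expected_criticality_le)
  have error_int: "integrable M (\<lambda>\<omega>. norm (g j \<omega> - G j \<omega>))" for j
    unfolding G by (rule error_integrable)
  have "0 \<le> \<kappa>\<^sub>1 \<and> (\<forall>j. (\<integral>\<omega>. norm (\<Xi> j \<omega>) \<partial>M)
      \<le> \<kappa>\<^sub>1 * (\<integral>\<omega>. norm (d j \<omega>) \<partial>M) + \<kappa>\<^sub>2 * (\<integral>\<omega>. norm (g j \<omega> - G j \<omega>) \<partial>M) + \<kappa>\<^sub>3)"
    using cases
  proof (elim disjE exE conjE)
    fix \<kappa>_opt
    assume "0 < \<kappa>_opt" "\<forall>k. (\<integral>\<omega>. norm (\<Xi> k \<omega>) \<partial>M) \<le> \<kappa>_opt * (\<integral>\<omega>. norm (d k \<omega>) \<partial>M)"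
      "\<kappa>\<^sub>1 = \<kappa>_opt" "\<kappa>\<^sub>2 = 0" "\<kappa>\<^sub>3 = 0"
    then show ?thesis
      by simp
  next
    fix \<kappa>_err1
    assume A: "0 < \<kappa>_err1"
      "\<forall>k. AE \<omega> in M. cond_exp_past M g k (\<lambda>\<omega>. norm (g k \<omega> - G k \<omega>)) \<omega>
                    \<le> \<kappa>_err1 * cond_exp_past M g k (\<lambda>\<omega>. norm (d k \<omega>)) \<omega>"
      "\<kappa>\<^sub>1 = 1 + \<kappa>_err1" "\<kappa>\<^sub>2 = 0" "\<kappa>\<^sub>3 = 0"
    have "(\<integral>\<omega>. norm (g j \<omega> - G j \<omega>) \<partial>M) \<le> \<kappa>_err1 * (\<integral>\<omega>. norm (d j \<omega>) \<partial>M)" for j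
      using A(2) by (intro past.integral_le_of_real_cond_exp_le error_int norm_d_integrable) blast
    then have "(\<integral>\<omega>. norm (\<Xi> j \<omega>) \<partial>M) \<le> (1 + \<kappa>_err1) * (\<integral>\<omega>. norm (d j \<omega>) \<partial>M)" for j
      using general[of j] unfolding distrib_right mult_1 by (meson add_left_mono order_trans)
    then show ?thesis
      using A by simp
  next
    fix p \<kappa>_err2 \<kappa>_pec
    assume A: "0 < p" "p < 1" "0 \<le> \<kappa>_err2" "0 \<le> \<kappa>_pec"
      "\<forall>k. AE \<omega> in M. norm (g k \<omega> - G k \<omega>) < \<kappa>_err2"
      "\<forall>k. AE \<omega> in M. p \<le> cond_prob_past M g k
                 {\<omega> \<in> space M. norm (g k \<omega> - G k \<omega>) \<le> \<kappa>_pec * norm (d k \<omega>)} \<omega>"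
      "\<kappa>\<^sub>1 = 1 + \<kappa>_pec" "\<kappa>\<^sub>2 = 0" "\<kappa>\<^sub>3 = (1 - p) * \<kappa>_err2"
    have "(\<integral>\<omega>. norm (g j \<omega> - G j \<omega>) \<partial>M) \<le> \<kappa>_pec * (\<integral>\<omega>. norm (d j \<omega>) \<partial>M) + (1 - p) * \<kappa>_err2" for j
    proof -
      define E where "E = {\<omega> \<in> space M. norm (g j \<omega> - G j \<omega>) \<le> \<kappa>_pec * norm (d j \<omega>)}"
      have [measurable]: "E \<in> sets M"
        unfolding E_def G by measurable
      have ind: "integrable M (indicator E :: _ \<Rightarrow> real)"
        by (simp add: emeasure_eq_measure)
      have "(\<integral>\<omega>. p \<partial>M) \<le> (\<integral>\<omega>. cond_prob_past M g j E \<omega> \<partial>M)"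
        using A(6) ind unfolding E_def
        by (intro integral_mono_AE past.real_cond_exp_int) auto
      also have "\<dots> = measure M E"
        using ind by (simp add: past.real_cond_exp_int)
      finally have p: "p \<le> measure M E"
        by (simp add: prob_space)
      have "(\<integral>\<omega>. norm (g j \<omega> - G j \<omega>) \<partial>M)
          \<le> (\<integral>\<omega>. \<kappa>_pec * norm (d j \<omega>) + \<kappa>_err2 * (1 - indicator E \<omega>) \<partial>M)"
      proof (rule integral_mono_AE)
        \<comment> \<open>On \<open>E\<close> the error is controlled by \<open>d\<close>; off \<open>E\<close> the uniform bound applies, with probability at most \<open>1 - p\<close>.\<close>
        show "AE \<omega> in M. norm (g j \<omega> - G j \<omega>) \<le> \<kappa>_pec * norm (d j \<omega>) + \<kappa>_err2 * (1 - indicator E \<omega>)"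
          using A(5)[rule_format, of j] AE_space
        proof eventually_elim
          case (elim \<omega>)
          then show ?case
            using A(4) by (cases "\<omega> \<in> E") (auto simp: E_def add_increasing)
        qed
      qed (use error_int norm_d_integrable ind in auto)
      also have "\<dots> = \<kappa>_pec * (\<integral>\<omega>. norm (d j \<omega>) \<partial>M) + \<kappa>_err2 * (1 - measure M E)"
        using norm_d_integrable ind by (simp add: prob_space)
      also have "\<kappa>_err2 * (1 - measure M E) \<le> \<kappa>_err2 * (1 - p)"
        using A(3) p by (intro mult_left_mono) auto
      finally show ?thesis
        by (simp add: mult.commute)
    qed
    then have "(\<integral>\<omega>. norm (\<Xi> j \<omega>) \<partial>M)
        \<le> (1 + \<kappa>_pec) * (\<integral>\<omega>. norm (d j \<omega>) \<partial>M) + (1 - p) * \<kappa>_err2" for j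
      using general[of j] unfolding distrib_right mult_1 add.assoc
      by (meson add_left_mono order_trans)
    then show ?thesis
      using A by simp
  next
    assume "\<kappa>\<^sub>1 = 1" "\<kappa>\<^sub>2 = 1" "\<kappa>\<^sub>3 = 0"
    then show ?thesis
      using general by simp
  qed
  then have "0 \<le> \<kappa>\<^sub>1" and \<Xi>_le: "\<And>j. (\<integral>\<omega>. norm (\<Xi> j \<omega>) \<partial>M)
      \<le> \<kappa>\<^sub>1 * (\<integral>\<omega>. norm (d j \<omega>) \<partial>M) + \<kappa>\<^sub>2 * (\<integral>\<omega>. norm (g j \<omega> - G j \<omega>) \<partial>M) + \<kappa>\<^sub>3"
    by auto
  have "(\<Sum>j=0..k. \<integral>\<omega>. norm (\<Xi> j \<omega>) \<partial>M)
      \<le> \<kappa>\<^sub>1 * (\<Sum>j\<le>k. \<integral>\<omega>. norm (d j \<omega>) \<partial>M)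
         + \<kappa>\<^sub>2 * (\<Sum>j=0..k. \<integral>\<omega>. norm (g j \<omega> - G j \<omega>) \<partial>M) + (k + 1) * \<kappa>\<^sub>3"
    using sum_mono[of "{..k}", OF \<Xi>_le]
    by (simp add: sum.distrib sum_distrib_left atLeast0AtMost algebra_simps)
  also have "\<dots> \<le> \<kappa>\<^sub>1 * (sqrt (k + 1) * \<kappa>_conv)
         + \<kappa>\<^sub>2 * (\<Sum>j=0..k. \<integral>\<omega>. norm (g j \<omega> - G j \<omega>) \<partial>M) + (k + 1) * \<kappa>\<^sub>3"
    using mult_left_mono[OF d_sum \<open>0 \<le> \<kappa>\<^sub>1\<close>] by simp
  finally have "1 / real (k + 1) * (\<Sum>j=0..k. \<integral>\<omega>. norm (\<Xi> j \<omega>) \<partial>M)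
      \<le> 1 / real (k + 1) * (\<kappa>\<^sub>1 * (sqrt (k + 1) * \<kappa>_conv)
         + \<kappa>\<^sub>2 * (\<Sum>j=0..k. \<integral>\<omega>. norm (g j \<omega> - G j \<omega>) \<partial>M) + (k + 1) * \<kappa>\<^sub>3)"
    by (intro mult_left_mono) auto
  also have "\<dots> = \<kappa>_conv * \<kappa>\<^sub>1 * (sqrt (real (k + 1)) / real (k + 1))
         + \<kappa>\<^sub>2 * (1 / real (k + 1) * (\<Sum>j=0..k. \<integral>\<omega>. norm (g j \<omega> - G j \<omega>) \<partial>M)) + \<kappa>\<^sub>3"
  proof -
    have "1 / m * (\<kappa>\<^sub>1 * (r * \<kappa>_conv) + \<kappa>\<^sub>2 * E + m * \<kappa>\<^sub>3)
        = \<kappa>_conv * \<kappa>\<^sub>1 * (r / m) + \<kappa>\<^sub>2 * (1 / m * E) + \<kappa>\<^sub>3" if "0 < m" for m r E :: real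
      using that by (simp add: field_simps)
    then show ?thesis
      by simp
  qed
  also have "sqrt (real (k + 1)) / real (k + 1) = 1 / sqrt (real (k + 1))"
    by (simp add: real_div_sqrt sqrt_divide_self_eq inverse_eq_divide)
  finally show "1 / real (k + 1) * (\<Sum>j=0..k. \<integral>\<omega>. norm (\<Xi> j \<omega>) \<partial>M)
      \<le> \<kappa>_conv * \<kappa>\<^sub>1 / sqrt (real (k + 1))
         + \<kappa>\<^sub>2 * (1 / real (k + 1) * (\<Sum>j=0..k. \<integral>\<omega>. norm (g j \<omega> - G j \<omega>) \<partial>M)) + \<kappa>\<^sub>3"
    by simp
qed

end
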